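(* Let $n\ge 1$, $\gamma\in(0,1)$, $T>0$, $\tau>0$, $s>0$, $p>0$, $E>0$, $\delta>0$, and $0\le h\le 1/2$. Let $u$ be the solution of the final value problem $\partial_t^\gamma u=\Delta u$ on $\mathbb{R}^n\times(0,T)$, $u(\cdot,T)=g$, with $u(\cdot,0)\in H^p(\mathbb{R}^n)$ and $\|u(\cdot,0)\|_{H^p}\le E$; let $g^\delta\in L^2(\mathbb{R}^n)$ satisfy $\|g-g^\delta\|_{L^2}\le\delta$; let $\psi_h$ be a positive function on $[0,\infty)\times(0,T]$ such that $$\forall t\in(0,T],\qquad \left\|\frac{\psi_h(|\xi|,t)-E_{\gamma,1}(-|\xi|^2t^\gamma)}{E_{\gamma,1}(-|\xi|^2t^\gamma)}\right\|_{\infty}\le h$$ (supremum norm over $\xi\in\mathbb{R}^n$); and for $\alpha>0$ let $u_\alpha^{\delta,h}(\cdot,0)$ be defined by $\widehat{u_\alpha^{\delta,h}}(\xi,0)=e^{-\tau(\alpha|\xi|)^s}\,\dfrac{\widehat{g^\delta}(\xi)}{\psi_h(|\xi|,T)}$. Then, for the a-priori choice $\alpha(\delta,h)=(h+\delta/E)^{\frac1{p+2}}$, for all $l\in[0,p]$ such that $p-l\le s$, $$\big\|u(\cdot,0)-u_{\alpha(\delta,h)}^{\delta,h}(\cdot,0)\big\|_{H^l}\le C\,E^{\frac{2+l}{p+2}}\,(\delta+hE)^{\frac{p-l}{p+2}},$$ where $C$ is a constant independent of $\delta$, $h$ and $E$.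
   Context: The Fourier transform is $\widehat f(\xi)=(2\pi)^{-n/2}\int_{\mathbb{R}^n}f(x)e^{-ix\cdot\xi}\,dx$, and $\|f\|_{H^p}=\|(1+|\xi|^2)^{p/2}\widehat f\|_{L^2}$. $\partial_t^\gamma$ is the Caputo derivative $\partial_t^\gamma u(t)=\frac{1}{\Gamma(1-\gamma)}\int_0^t\frac{u'(r)}{(t-r)^\gamma}\,dr$. $E_{\gamma,1}(z)=\sum_{k\ge0}\frac{z^k}{\Gamma(\gamma k+1)}$ is the Mittag-Leffler function. A solution of $\partial_t^\gamma u=\Delta u$ is understood through its frequency representation $\widehat u(\xi,t)=\widehat u(\xi,0)\,E_{\gamma,1}(-|\xi|^2t^\gamma)$, $t\in[0,T]$ (transform in $x$); thus $\widehat g(\xi)=\widehat u(\xi,0)E_{\gamma,1}(-|\xi|^2T^\gamma)$ for $g=u(\cdot,T)$. The function $\psi_h$ models an approximate evaluation of the Mittag-Leffler function. Here $E>0$ (a bound on the Sobolev norm) is not to be confused with the function $E_{\gamma,1}$.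
   Formalization: The formal theorem adds the hypothesis δ ≤ M·E for an arbitrary fixed M, and C may depend on M; with C uniform over all δ, E the estimate fails (u=0, h=0, E=1, low-frequency noise of norm δ→∞). *)

theory Defs
  imports "HOL-Probability.Probability"
begin

text \<open>
  The space \<open>\<real>\<^sup>n\<close> with \<open>n \<ge> 1\<close> is an arbitrary type of class \<open>euclidean_space\<close> with Lebesgue measure
  \<open>lborel\<close>. Elements of \<open>L\<^sup>2\<close> are represented by (Borel) functions, not by classes modulo null sets;
  equalities between such functions are therefore stated almost everywhere.
\<close>

definition L2_space :: "('a::euclidean_space \<Rightarrow> complex) set" where
  "L2_space = {f \<in> borel_measurable lborel. integrable lborel (\<lambda>x. (norm (f x))\<^sup>2)}"

text \<open>Only meaningful on \<open>L2_space\<close>: the Bochner integral is 0 for non-integrable functions.\<close>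

definition L2_norm :: "('a::euclidean_space \<Rightarrow> complex) \<Rightarrow> real" where
  "L2_norm f = sqrt (LINT x|lborel. (norm (f x))\<^sup>2)"

definition fourier_integral :: "('a::euclidean_space \<Rightarrow> complex) \<Rightarrow> 'a \<Rightarrow> complex" where
  "fourier_integral f \<xi> =
     of_real ((2 * pi) powr (- real DIM('a) / 2)) *
     (LINT x|lborel. f x * exp (- \<i> * of_real (x \<bullet> \<xi>)))"

text \<open>
  The integral need not exist for \<open>f \<in> L\<^sup>2\<close>. As usual (Plancherel) the transform of \<open>f\<close> is then the
  limit in \<open>L\<^sup>2\<close> of the transforms of the truncations of \<open>f\<close> to balls, which are integrable; it is
  determined up to a null set. The limit is expressed by a nonnegative integral, so that no
  integrability has to be checked for it to be meaningful.
\<close>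

definition is_fourier_L2 ::
    "('a::euclidean_space \<Rightarrow> complex) \<Rightarrow> ('a \<Rightarrow> complex) \<Rightarrow> bool" where
  "is_fourier_L2 f F \<longleftrightarrow>
     F \<in> L2_space \<and>
     ((\<lambda>R::real. \<integral>\<^sup>+\<xi>. ennreal ((norm (F \<xi> -
          fourier_integral (\<lambda>x. if norm x \<le> R then f x else 0) \<xi>))\<^sup>2) \<partial>lborel) \<longlongrightarrow> 0) at_top"

definition fourier :: "('a::euclidean_space \<Rightarrow> complex) \<Rightarrow> 'a \<Rightarrow> complex" where
  "fourier f = (SOME F. is_fourier_L2 f F)"

text \<open>Sobolev spaces are used for exponents \<open>p \<ge> 0\<close> only, where they are subspaces of \<open>L\<^sup>2\<close>.\<close>

definition sobolev_weighted ::
    "real \<Rightarrow> ('a::euclidean_space \<Rightarrow> complex) \<Rightarrow> 'a \<Rightarrow> complex" where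
  "sobolev_weighted p f \<xi> = of_real ((1 + (norm \<xi>)\<^sup>2) powr (p / 2)) * fourier f \<xi>"

definition sobolev_space :: "real \<Rightarrow> ('a::euclidean_space \<Rightarrow> complex) set" where
  "sobolev_space p = {f \<in> L2_space. sobolev_weighted p f \<in> L2_space}"

definition sobolev_norm :: "real \<Rightarrow> ('a::euclidean_space \<Rightarrow> complex) \<Rightarrow> real" where
  "sobolev_norm p f = L2_norm (sobolev_weighted p f)"

definition sup_norm :: "('a \<Rightarrow> real) \<Rightarrow> ereal" where
  "sup_norm f = (SUP x. ereal \<bar>f x\<bar>)"

text \<open>\<open>mittag_leffler \<gamma>\<close> is \<open>E\<^bsub>\<gamma>,1\<^esub>\<close> on the real line.\<close>

definition mittag_leffler :: "real \<Rightarrow> real \<Rightarrow> real" where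
  "mittag_leffler \<gamma> z = (\<Sum>k. z ^ k / Gamma (\<gamma> * real k + 1))"

text \<open>
  Solutions \<open>u t = u(\<cdot>,t)\<close>, \<open>t \<in> [0,T]\<close>, of \<open>\<partial>\<^sub>t\<^sup>\<gamma> u = \<Delta> u\<close> in the sense of the frequency representation.
\<close>

definition is_solution :: "real \<Rightarrow> real \<Rightarrow> (real \<Rightarrow> 'a::euclidean_space \<Rightarrow> complex) \<Rightarrow> bool" where
  "is_solution \<gamma> T u \<longleftrightarrow>
     (\<forall>t\<in>{0..T}. u t \<in> L2_space \<and>
       (AE \<xi> in lborel. fourier (u t) \<xi> =
          fourier (u 0) \<xi> * of_real (mittag_leffler \<gamma> (- (norm \<xi>)\<^sup>2 * t powr \<gamma>))))"

definition is_final_value_solution ::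
    "real \<Rightarrow> real \<Rightarrow> ('a::euclidean_space \<Rightarrow> complex) \<Rightarrow> (real \<Rightarrow> 'a \<Rightarrow> complex) \<Rightarrow> bool" where
  "is_final_value_solution \<gamma> T g u \<longleftrightarrow>
     is_solution \<gamma> T u \<and> g \<in> L2_space \<and> (AE x in lborel. u T x = g x)"

definition approximates_mittag_leffler ::
    "'a::euclidean_space itself \<Rightarrow> real \<Rightarrow> real \<Rightarrow> real \<Rightarrow> (real \<Rightarrow> real \<Rightarrow> real) \<Rightarrow> bool" where
  "approximates_mittag_leffler _ \<gamma> T h \<psi> \<longleftrightarrow>
     (\<forall>r\<ge>0. \<forall>t\<in>{0<..T}. \<psi> r t > 0) \<and>
     (\<forall>t\<in>{0<..T}.
        sup_norm (\<lambda>\<xi>::'a. (\<psi> (norm \<xi>) t - mittag_leffler \<gamma> (- (norm \<xi>)\<^sup>2 * t powr \<gamma>)) /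
                         mittag_leffler \<gamma> (- (norm \<xi>)\<^sup>2 * t powr \<gamma>)) \<le> ereal h)"

text \<open>\<open>v\<close> is the function \<open>u\<^sub>\<alpha>(\<cdot>,0)\<close> reconstructed from the final data \<open>g\<close>.\<close>

definition is_regularized_initial_value ::
    "real \<Rightarrow> real \<Rightarrow> real \<Rightarrow> (real \<Rightarrow> real \<Rightarrow> real) \<Rightarrow> real \<Rightarrow>
     ('a::euclidean_space \<Rightarrow> complex) \<Rightarrow> ('a \<Rightarrow> complex) \<Rightarrow> bool" where
  "is_regularized_initial_value \<tau> s T \<psi> \<alpha> g v \<longleftrightarrow>
     v \<in> L2_space \<and>
     (AE \<xi> in lborel. fourier v \<xi> =
        of_real (exp (- \<tau> * (\<alpha> * norm \<xi>) powr s)) * (fourier g \<xi> / of_real (\<psi> (norm \<xi>) T)))"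

end

theory Submission imports Defs begin

text \<open>
  Let \<open>w\<close> be the difference of the Fourier transforms of the exact and the reconstructed initial value.
  It splits into a smoothing error, a relative error at most \<open>2 h\<close> from replacing \<open>E\<^bsub>\<gamma>,1\<^esub>\<close> by \<open>\<psi>\<close>,
  and the data error divided by \<open>\<psi>\<close>. With \<open>1 - exp(- \<tau> y\<^sup>s) \<le> C y\<^sup>p\<^sup>-\<^sup>l\<close> the first contributes
  \<open>O(E \<alpha>\<^sup>p\<^sup>-\<^sup>l)\<close> in \<open>H\<^sup>l\<close>. The lower bound \<open>E\<^bsub>\<gamma>,1\<^esub>(-x) \<ge> 1 / (1 + \<Gamma>(1 - \<gamma>) x)\<close> shows that dividing by \<open>\<psi>\<close> costs
  at most a factor of order \<open>1 + |\<xi>|\<^sup>2\<close>, so the exponential filter bounds the third contribution by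
  \<open>O(\<delta> \<alpha>\<^sup>-\<^sup>l\<^sup>-\<^sup>2)\<close> as long as \<open>\<alpha>\<close> stays bounded. The choice \<open>\<alpha>\<^sup>p\<^sup>+\<^sup>2 = h + \<delta>/E\<close> balances all three.
  On the Fourier side no isometry is needed: the transform is linear on \<open>L\<^sup>2\<close> almost everywhere
  and bounded, which follows from a Gaussian-regularized Bessel inequality.
\<close>

section \<open>A lower bound for the Mittag-Leffler function\<close>

text \<open>The alternating series of E_{\<gamma>,1}(-x) reveals neither sign nor size, while a
  lower bound of order 1/x is required so that dividing by it costs no more than two derivatives.
  One fact supplies it: E_{\<gamma>,\<gamma>} is positive on the negative half-axis, and two
  integral representations transfer this to E_{\<gamma>,1}.
  \<open>mittag_leffler2 \<gamma> b\<close> is the two-parameter function E_{\<gamma>,b}; the second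
  parameter makes the family closed under convolution with power kernels, which only raises b. Since
  \<gamma> < 1, these kernels are singular at endpoints, hence the gauge integrals and the care
  taken at single points where \<open>0 powr x = 0\<close>. On the Fourier side the obstacle is that
  \<open>fourier\<close> merely selects a representative, so its linearity and its compatibility
  with almost everywhere equality have to be drawn from an L2 bound. A bound with a constant
  suffices, because constants are absorbed in C.\<close>

definition mittag_leffler2 :: "real \<Rightarrow> real \<Rightarrow> real \<Rightarrow> real" where
  "mittag_leffler2 \<gamma> b z = (\<Sum>k. z ^ k / Gamma (\<gamma> * real k + b))"

text \<open>Only the range t \<ge> A of Euler's integral is kept, where t^(y-1) \<ge> A^(y-1). As A
  is free, Gamma outgrows every geometric sequence; this takes the place of Stirling's
  formula.\<close>

lemma Gamma_real_ge_powr_exp: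
  fixes y A :: real
  assumes "y \<ge> 1" "A > 0"
  shows "A powr (y - 1) * exp (- A) \<le> Gamma y"
proof (rule has_integral_le)
  have "((\<lambda>x::real. exp (-1*x)) has_integral exp (-1*A)/1) {A..}"
    by (rule has_integral_exp_minus_to_infinity) simp
  hence "((\<lambda>x::real. A powr (y - 1) * exp (-x)) has_integral (A powr (y - 1) * exp (- A))) {A..}"
    by (intro has_integral_mult_right) simp
  hence "((\<lambda>x. if x \<in> {A..} then A powr (y - 1) * exp (-x) else 0) has_integral
      (A powr (y - 1) * exp (- A))) {0..}"
    by (subst has_integral_restrict) (use assms in auto)
  thus "((\<lambda>x. if x \<in> {A..} then A powr (y - 1) * exp (-x) else 0) has_integral
      (A powr (y - 1) * exp (- A))) {0..}" .
  show "((\<lambda>t. t powr (y - 1) / exp t) has_integral Gamma y) {0..}"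
    using assms by (intro Gamma_integral_real) auto
  fix x :: real assume "x \<in> {0..}"
  show "(if x \<in> {A..} then A powr (y - 1) * exp (- x) else 0) \<le> x powr (y - 1) / exp x"
    using assms by (auto simp: exp_minus field_simps intro!: powr_mono2)
qed

lemma summable_mittag_leffler2:
  fixes \<gamma> b z :: real
  assumes "\<gamma> > 0" "b > 0"
  shows "summable (\<lambda>k. z ^ k / Gamma (\<gamma> * real k + b))"
proof -
  \<comment> \<open>Chosen so that A^\<gamma> = 2 (|z| + 1): the k-th denominator then exceeds (|z|
    + 1)^k by a factor of order 2^k. The summand 1 keeps A positive for z = 0.\<close>
  define A where "A = (2 * (\<bar>z\<bar> + 1)) powr (1 / \<gamma>)"
  have A: "A > 0" "A powr \<gamma> = 2 * (\<bar>z\<bar> + 1)"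
    using assms unfolding A_def by (auto simp: powr_powr)
  \<comment> \<open>From this index on \<gamma> k \<ge> 1, so the argument of Gamma is at least
    1.\<close>
  define N where "N = nat \<lceil>1 / \<gamma>\<rceil>"
  show ?thesis
  proof (rule summable_comparison_test')
    show "summable (\<lambda>k. (exp A * A powr (1 - b)) * (1/2) ^ k)"
      by (intro summable_mult summable_geometric) auto
    fix k assume "k \<ge> N"
    hence "1 / \<gamma> \<le> real k" unfolding N_def by linarith
    hence "1 \<le> \<gamma> * real k" using assms by (simp add: field_simps)
    hence y: "\<gamma> * real k + b \<ge> 1" using assms by linarith
    have "A powr (\<gamma> * real k + b - 1) * exp (- A) \<le> Gamma (\<gamma> * real k + b)"
      by (rule Gamma_real_ge_powr_exp[OF y A(1)])
    moreover have "A powr (\<gamma> * real k + b - 1) = (2 * (\<bar>z\<bar> + 1)) ^ k / A powr (1 - b)"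
      using A by (simp add: powr_add powr_diff powr_powr[symmetric] powr_realpow)
    ultimately have G: "(2 * (\<bar>z\<bar> + 1)) ^ k / A powr (1 - b) * exp (- A) \<le> Gamma (\<gamma> * real k + b)"
      by simp
    have pos: "(2 * (\<bar>z\<bar> + 1)) ^ k / A powr (1 - b) * exp (- A) > 0" using A by auto
    have "norm (z ^ k / Gamma (\<gamma> * real k + b)) = \<bar>z\<bar> ^ k / Gamma (\<gamma> * real k + b)"
      using y Gamma_real_pos[of "\<gamma> * real k + b"] by (simp add: power_abs)
    also have "\<dots> \<le> (\<bar>z\<bar> + 1) ^ k / ((2 * (\<bar>z\<bar> + 1)) ^ k / A powr (1 - b) * exp (- A))"
      using G pos by (intro frac_le power_mono) auto
    also have "\<dots> = (exp A * A powr (1 - b)) * (1/2) ^ k"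
      unfolding power_mult_distrib[of 2] using A by (simp add: exp_minus field_simps)
    finally show "norm (z ^ k / Gamma (\<gamma> * real k + b)) \<le> (exp A * A powr (1 - b)) * (1/2) ^ k" .
  qed
qed

lemma isCont_mittag_leffler2:
  assumes "\<gamma> > 0" "b > 0"
  shows "isCont (mittag_leffler2 \<gamma> b) z"
proof -
  have "isCont (\<lambda>x. \<Sum>k. (1 / Gamma (\<gamma> * real k + b)) * x ^ k) z"
    using summable_mittag_leffler2[OF assms] by (intro isCont_powser_converges_everywhere) simp
  thus ?thesis unfolding mittag_leffler2_def[abs_def] by simp
qed

lemma mittag_leffler2_0: "mittag_leffler2 \<gamma> b 0 = 1 / Gamma b"
  unfolding mittag_leffler2_def by (subst suminf_finite[of "{0}"]) auto

text \<open>Splitting off the term k = 0 raises b by \<gamma>. Read backwards, it expresses a value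
  at \<gamma> + b, as produced by convolution, through the value at b.\<close>

lemma mittag_leffler2_shift:
  assumes "\<gamma> > 0" "b > 0"
  shows "mittag_leffler2 \<gamma> b z = 1 / Gamma b + z * mittag_leffler2 \<gamma> (\<gamma> + b) z"
proof -
  have "mittag_leffler2 \<gamma> b z = (\<Sum>k. z ^ Suc k / Gamma (\<gamma> * real (Suc k) + b)) + 1 / Gamma b"
    unfolding mittag_leffler2_def
    using suminf_split_head[OF summable_mittag_leffler2[OF assms, of z]] by simp
  also have "(\<Sum>k. z ^ Suc k / Gamma (\<gamma> * real (Suc k) + b)) = 
     (\<Sum>k. z * (z ^ k / Gamma (\<gamma> * real k + (\<gamma> + b))))"
    by (simp add: algebra_simps)
  also have "\<dots> = z * mittag_leffler2 \<gamma> (\<gamma> + b) z"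
    unfolding mittag_leffler2_def using assms by (intro suminf_mult summable_mittag_leffler2) auto
  finally show ?thesis by simp
qed

section \<open>Convolution with power kernels\<close>

lemma has_integral_powr_convolution:
  fixes a b t :: real
  assumes "a > 0" "b > 0" "t > 0"
  shows "((\<lambda>s. (t - s) powr (a - 1) * s powr (b - 1)) has_integral
           (t powr (a + b - 1) * Beta a b)) {0..t}"
proof -
  \<comment> \<open>Euler's Beta integral, rescaled from [0,1] to [0,t].\<close>
  have "((\<lambda>s. s powr (b - 1) * (1 - s) powr (a - 1)) has_integral Beta b a) (cbox 0 1)"
    using has_integral_Beta_real[of b a] assms by simp
  from has_integral_affinity'[OF this, of "1 / t" 0]
  have "((\<lambda>s. (s / t) powr (b - 1) * (1 - s / t) powr (a - 1)) has_integral (t * Beta b a)) {0..t}"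
    using assms by (simp add: divide_inverse mult.commute)
  hence I: "((\<lambda>s. t powr (a + b - 2) * ((s / t) powr (b - 1) * (1 - s / t) powr (a - 1)))
      has_integral (t powr (a + b - 2) * (t * Beta b a))) {0..t}"
    by (rule has_integral_mult_right)
  have c: "t powr (a + b - 2) * (t * Beta b a) = t powr (a + b - 1) * Beta a b"
  proof -
    have "t powr (a + b - 2) * t = t powr (a + b - 2) * t powr 1" using assms by simp
    also have "\<dots> = t powr (a + b - 1)" unfolding powr_add[symmetric] by simp
    finally show ?thesis by (simp add: Beta_commute)
  qed
  have eq: "t powr (a + b - 2) * ((s / t) powr (b - 1) * (1 - s / t) powr (a - 1)) =
      (t - s) powr (a - 1) * s powr (b - 1)" if "s \<in> {0..t}" for s
  proof -
    have "1 - s / t = (t - s) / t" using assms by (simp add: field_simps)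
    hence "(s / t) powr (b - 1) * (1 - s / t) powr (a - 1) =
       s powr (b - 1) * (t - s) powr (a - 1) / (t powr (b - 1) * t powr (a - 1))"
      using that assms by (simp add: powr_divide)
    also have "t powr (b - 1) * t powr (a - 1) = t powr (a + b - 2)"
      unfolding powr_add[symmetric] by (simp add: algebra_simps)
    finally show ?thesis using assms by (simp add: field_simps)
  qed
  from I show ?thesis unfolding c by (rule has_integral_eq[rotated]) (rule eq)
qed

text \<open>Up to the factor \<open>Gamma a\<close> this is the Riemann-Liouville integral of order
  a. In each term \<open>Beta a (\<gamma> * real k + b)\<close> trades the denominator
  Gamma(\<gamma> k + b) for Gamma(\<gamma> k + a + b), so the series keeps its form and only b
  changes.\<close>

lemma has_integral_mittag_leffler2_convolution:
  fixes \<gamma> a b t :: real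
  assumes "\<gamma> > 0" "a > 0" "b > 0" "t > 0"
  shows "((\<lambda>s. (t - s) powr (a - 1) * (s powr (b - 1) * mittag_leffler2 \<gamma> b (- (s powr \<gamma>))))
     has_integral (Gamma a * t powr (a + b - 1) * mittag_leffler2 \<gamma> (a + b) (- (t powr \<gamma>)))) {0..t}"
proof -
  define G where "G = (\<lambda>k. Gamma (\<gamma> * real k + b))"
  have Gpos: "G k > 0" for k unfolding G_def using assms by (intro Gamma_real_pos add_nonneg_pos) auto
  define P where "P = (\<lambda>k s. (t - s) powr (a - 1) * s powr (\<gamma> * real k + b - 1))"
  define c where "c = (\<lambda>k. t powr (\<gamma> * real k + (a + b) - 1) * (Gamma a * G k / Gamma (\<gamma> * real k + (a + b))))"
  have bk: "\<gamma> * real k + b > 0" for k using assms by (intro add_nonneg_pos) auto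
  have P_int: "(P k has_integral c k) {0..t}" for k
    using has_integral_powr_convolution[of a "\<gamma> * real k + b" t] assms bk[of k]
    unfolding P_def c_def Beta_def G_def by (simp add: algebra_simps)
  have P_nonneg: "P k s \<ge> 0" for k s unfolding P_def by simp
  \<comment> \<open>Nonnegativity upgrades the gauge integral to a Lebesgue integral, for which
    series can be integrated termwise.\<close>
  have P_abs: "set_integrable lebesgue {0..t} (P k)" for k
    using P_int[of k] P_nonneg by (intro nonnegative_absolutely_integrable_1) auto
  have P_L: "(LINT s:{0..t}|lebesgue. P k s) = c k" for k
    using set_lebesgue_integral_eq_integral(2)[OF P_abs[of k]] P_int[of k] by (simp add: integral_unique)
  define F where "F = (\<lambda>k s. indicator {0..t} s *\<^sub>R P k s * ((- 1) ^ k / G k))"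
  have F_int: "integrable lebesgue (F k)" for k
    using P_abs[of k] unfolding F_def set_integrable_def by (intro integrable_mult_left) auto
  have F_sum: "integral\<^sup>L lebesgue (F k) = c k * ((- 1) ^ k / G k)" for k
    using P_L[of k] P_abs[of k] unfolding F_def set_integrable_def set_lebesgue_integral_def
    by (subst integral_mult_left_zero) auto
  have norm_F: "norm (F k s) = indicator {0..t} s *\<^sub>R P k s * (1 / G k)" for k s
    using P_nonneg[of k s] Gpos[of k] unfolding F_def by (simp add: abs_mult)
  have F_norm: "(LINT s|lebesgue. norm (F k s)) = c k * (1 / G k)" for k
    unfolding norm_F using P_L[of k] unfolding set_lebesgue_integral_def
    by (subst integral_mult_left_zero) auto
  have P_eq: "P k s = (t - s) powr (a - 1) * s powr (b - 1) * (s powr \<gamma>) ^ k" if "s \<ge> 0" for k s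
  proof (cases "s = 0")
    \<comment> \<open>\<open>0 powr x = 0\<close> for every x, so both sides vanish whatever the
      sign of b - 1.\<close>
    case True thus ?thesis by (simp add: P_def)
  next
    case False
    hence "s powr (\<gamma> * real k + b - 1) = s powr (b - 1 + \<gamma> * real k)" by (simp add: algebra_simps)
    also have "\<dots> = s powr (b - 1) * (s powr \<gamma>) ^ k"
      unfolding powr_add using False that by (simp add: powr_powr[symmetric] powr_realpow)
    finally show ?thesis by (simp add: P_def)
  qed
  have F_eq: "F k s = indicator {0..t} s * ((t - s) powr (a - 1) * s powr (b - 1)) *
     ((- (s powr \<gamma>)) ^ k / G k)" for k s
    unfolding F_def by (auto simp: indicator_def P_eq power_minus[of "s powr \<gamma>"])
  have nF_eq: "norm (F k s) = indicator {0..t} s * ((t - s) powr (a - 1) * s powr (b - 1)) *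
     ((s powr \<gamma>) ^ k / G k)" for k s
    unfolding norm_F by (auto simp: indicator_def P_eq)
  have cG: "c k * ((- 1) ^ k / G k) = Gamma a * t powr (a + b - 1) * 
     ((- (t powr \<gamma>)) ^ k / Gamma (\<gamma> * real k + (a + b)))"
    and cG': "c k * (1 / G k) = Gamma a * t powr (a + b - 1) * 
     ((t powr \<gamma>) ^ k / Gamma (\<gamma> * real k + (a + b)))" for k
  proof -
    have "t powr (\<gamma> * real k + (a + b) - 1) = t powr (\<gamma> * real k + (a + b - 1))"
      by (simp add: algebra_simps)
    also have "\<dots> = (t powr \<gamma>) ^ k * t powr (a + b - 1)"
      unfolding powr_add using assms by (simp add: powr_powr[symmetric] powr_realpow)
    finally have "t powr (\<gamma> * real k + (a + b) - 1) = (t powr \<gamma>) ^ k * t powr (a + b - 1)" .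
    thus "c k * ((- 1) ^ k / G k) = Gamma a * t powr (a + b - 1) * 
       ((- (t powr \<gamma>)) ^ k / Gamma (\<gamma> * real k + (a + b)))"
      "c k * (1 / G k) = Gamma a * t powr (a + b - 1) * 
       ((t powr \<gamma>) ^ k / Gamma (\<gamma> * real k + (a + b)))"
      using Gpos[of k] unfolding c_def by (simp_all add: field_simps power_minus[of "t powr \<gamma>"])
  qed
  \<comment> \<open>Taking norms removes the alternating sign: the dominating series are
    Mittag-Leffler series at the nonnegative arguments s^\<gamma> and t^\<gamma>, which converge as
    well.\<close>
  have s1: "AE s in lebesgue. summable (\<lambda>k. norm (F k s))"
    unfolding nF_eq G_def using assms by (intro AE_I2 summable_mult summable_mittag_leffler2) auto
  have s2: "summable (\<lambda>k. LINT s|lebesgue. norm (F k s))"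
    unfolding F_norm cG' using assms by (intro summable_mult summable_mittag_leffler2) auto
  have lim: "(\<Sum>k. F k s) = indicator {0..t} s *\<^sub>R
     ((t - s) powr (a - 1) * (s powr (b - 1) * mittag_leffler2 \<gamma> b (- (s powr \<gamma>))))" for s
    unfolding F_eq mittag_leffler2_def G_def using assms
    by (subst suminf_mult[OF summable_mittag_leffler2]) auto
  have "integrable lebesgue (\<lambda>s. \<Sum>k. F k s)" by (rule integrable_suminf[OF F_int s1 s2])
  hence I: "set_integrable lebesgue {0..t}
     (\<lambda>s. (t - s) powr (a - 1) * (s powr (b - 1) * mittag_leffler2 \<gamma> b (- (s powr \<gamma>))))"
    unfolding lim set_integrable_def .
  have "(LINT s|lebesgue. (\<Sum>k. F k s)) = (\<Sum>k. integral\<^sup>L lebesgue (F k))"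
    by (rule integral_suminf[OF F_int s1 s2])
  also have "\<dots> = (\<Sum>k. Gamma a * t powr (a + b - 1) *
      ((- (t powr \<gamma>)) ^ k / Gamma (\<gamma> * real k + (a + b))))"
    unfolding F_sum cG ..
  also have "\<dots> = Gamma a * t powr (a + b - 1) * mittag_leffler2 \<gamma> (a + b) (- (t powr \<gamma>))"
    unfolding mittag_leffler2_def using assms
    by (subst suminf_mult[OF summable_mittag_leffler2]) auto
  finally show ?thesis
    using has_integral_set_lebesgue[OF I] unfolding lim set_lebesgue_integral_def by simp
qed

text \<open>
  The function \<open>r(t) = t\<^sup>\<gamma>\<^sup>-\<^sup>1 E\<^bsub>\<gamma>,\<gamma>\<^esub>(-t\<^sup>\<gamma>)\<close> solves \<open>\<Gamma>(\<gamma>) r(t) = t\<^sup>\<gamma>\<^sup>-\<^sup>1 - \<integral>\<^sub>0\<^sup>t (t - s)\<^sup>\<gamma>\<^sup>-\<^sup>1 r(s) ds\<close>. Let \<open>t0\<close> be its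
  first zero. By logarithmic convexity of the kernel, \<open>(t0 - s)\<^sup>\<gamma>\<^sup>-\<^sup>1 \<le> (t0/m)\<^sup>\<gamma>\<^sup>-\<^sup>1 (m - s)\<^sup>\<gamma>\<^sup>-\<^sup>1\<close> for
  \<open>s < m < t0\<close>. Comparing the equations at \<open>t0\<close> and at a maximum point \<open>m\<close> of \<open>r\<close> on a short interval
  \<open>[t0 - d, t0]\<close> gives a contradiction, since the kernel has little mass on that interval.
\<close>

lemma mittag_leffler2_pos:
  fixes \<gamma> t :: real
  assumes \<gamma>: "0 < \<gamma>" "\<gamma> < 1" and "t > 0"
  shows "mittag_leffler2 \<gamma> \<gamma> (- (t powr \<gamma>)) > 0"
proof (rule ccontr)
  assume neg: "\<not> ?thesis"
  \<comment> \<open>The first zero is sought for q, not for r: q is continuous up to 0 with q(0) = 1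
    / Gamma \<gamma> > 0, which forces t0 > 0. The singular factor is confined to r.\<close>
  define q where "q = (\<lambda>t. mittag_leffler2 \<gamma> \<gamma> (- (t powr \<gamma>)))"
  define r where "r = (\<lambda>t. t powr (\<gamma> - 1) * q t)"
  have q_cont: "continuous_on {0..} q"
  proof -
    have "continuous_on UNIV (mittag_leffler2 \<gamma> \<gamma>)"
      using isCont_mittag_leffler2[OF \<gamma>(1) \<gamma>(1)] by (simp add: continuous_on_eq_continuous_at)
    moreover have "continuous_on {0..} (\<lambda>t::real. - (t powr \<gamma>))"
      using \<gamma> by (intro continuous_intros continuous_on_powr') auto
    ultimately show ?thesis unfolding q_def by (rule continuous_on_compose2) auto
  qed
  have r_cont: "continuous_on {0<..} r"
    unfolding r_def by (intro continuous_intros continuous_on_subset[OF q_cont]) auto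
  \<comment> \<open>Convolution with a = b = \<gamma> produces E_{\<gamma>,2\<gamma>}; the shift
    identity turns it back into r.\<close>
  have conv: "((\<lambda>s. (t - s) powr (\<gamma> - 1) * r s) has_integral (t powr (\<gamma> - 1) - Gamma \<gamma> * r t)) {0..t}"
    if "t > 0" for t
  proof -
    have "t powr (\<gamma> - 1) - Gamma \<gamma> * r t =
      Gamma \<gamma> * t powr (\<gamma> - 1) * (t powr \<gamma> * mittag_leffler2 \<gamma> (\<gamma> + \<gamma>) (- (t powr \<gamma>)))"
      (is "_ = _ * ?q2")
    proof -
      have "Gamma \<gamma> * q t = 1 - Gamma \<gamma> * ?q2"
      proof -
        have "q t = 1 / Gamma \<gamma> - ?q2"
          unfolding q_def using mittag_leffler2_shift[OF \<gamma>(1) \<gamma>(1), of "- (t powr \<gamma>)"] by simp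
        thus ?thesis using Gamma_real_pos[OF \<gamma>(1)] by (simp add: right_diff_distrib)
      qed
      thus ?thesis unfolding r_def by (simp add: algebra_simps) algebra
    qed
    also have "\<dots> = Gamma \<gamma> * t powr (\<gamma> + \<gamma> - 1) * mittag_leffler2 \<gamma> (\<gamma> + \<gamma>) (- (t powr \<gamma>))"
    proof -
      have "t powr (\<gamma> + \<gamma> - 1) = t powr (\<gamma> - 1) * t powr \<gamma>"
        unfolding powr_add[symmetric] by (simp add: algebra_simps)
      thus ?thesis by simp
    qed
    finally have e: "t powr (\<gamma> - 1) - Gamma \<gamma> * r t =
       Gamma \<gamma> * t powr (\<gamma> + \<gamma> - 1) * mittag_leffler2 \<gamma> (\<gamma> + \<gamma>) (- (t powr \<gamma>))" .
    show ?thesis unfolding e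
      using has_integral_mittag_leffler2_convolution[OF \<gamma>(1) \<gamma>(1) \<gamma>(1) that]
      unfolding r_def q_def .
  qed
  have "compact {x \<in> {0..t}. q x \<le> 0}"
  proof -
    have "closed {x \<in> {0..t}. q x \<le> 0}"
      by (intro continuous_on_closed_Collect_le continuous_on_subset[OF q_cont] continuous_intros) auto
    thus ?thesis
      by (rule compact_Int_closed[of "{0..t}" "{x \<in> {0..t}. q x \<le> 0}", OF compact_Icc, THEN back_subst[of compact]]) auto
  qed
  moreover have "t \<in> {x \<in> {0..t}. q x \<le> 0}" using neg \<open>t > 0\<close> by (auto simp: q_def)
  ultimately obtain t0 where t0: "t0 \<ge> 0" "q t0 \<le> 0" "t0 \<le> t" "\<And>x. x \<in> {0..t} \<Longrightarrow> q x \<le> 0 \<Longrightarrow> t0 \<le> x"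
    using compact_attains_inf[of "{x \<in> {0..t}. q x \<le> 0}"] by fastforce
  have "q 0 > 0" using \<gamma> by (simp add: q_def mittag_leffler2_0)
  hence t0_pos: "t0 > 0" using t0(1,2) by (cases "t0 = 0") auto
  have r_t0: "r t0 \<le> 0" using t0(2) by (simp add: r_def mult_nonneg_nonpos)
  have r_pos: "r x > 0" if "0 < x" "x < t0" for x
    using t0(4)[of x] t0(3) that by (force simp: r_def)
  have r_nonneg: "r x \<ge> 0" if "0 \<le> x" "x < t0" for x
    using r_pos[of x] that by (cases "x = 0") (auto simp: r_def)
  \<comment> \<open>The two entries serve the two halves of the contradiction: d \<le> t0/2 gives
    \<rho> \<ge> 1/2, and d^\<gamma> \<le> \<gamma> Gamma \<gamma> / 4 gives \<rho> \<le>
    1/4.\<close>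
  define d where "d = min (t0 / 2) ((\<gamma> * Gamma \<gamma> / 4) powr (1 / \<gamma>))"
  have Gp: "Gamma \<gamma> > 0" using \<gamma> by (intro Gamma_real_pos)
  have "\<gamma> * Gamma \<gamma> / 4 > 0" using mult_pos_pos[OF \<gamma>(1) Gp] by linarith
  hence "(\<gamma> * Gamma \<gamma> / 4) powr (1 / \<gamma>) > 0" unfolding powr_gt_zero by linarith
  hence d: "d > 0" "d \<le> t0 / 2" using t0_pos unfolding d_def by (simp_all only: min_less_iff_conj) auto
  have "d powr \<gamma> \<le> ((\<gamma> * Gamma \<gamma> / 4) powr (1 / \<gamma>)) powr \<gamma>"
    using d \<gamma> by (intro powr_mono2) (auto simp: d_def)
  hence d_powr: "d powr \<gamma> \<le> \<gamma> * Gamma \<gamma> / 4" using \<gamma> Gp by (simp add: powr_powr)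
  obtain m where m: "m \<in> {t0 - d..t0}" "\<And>x. x \<in> {t0 - d..t0} \<Longrightarrow> r x \<le> r m"
  proof -
    have "continuous_on {t0 - d..t0} r" using d t0_pos
      by (intro continuous_on_subset[OF r_cont]) auto
    thus ?thesis using continuous_attains_sup[of "{t0 - d..t0}" r] d that by fastforce
  qed
  \<comment> \<open>The left endpoint already has a positive value, so the maximum is positive and
    is not attained at t0.\<close>
  have "r m > 0" using m(2)[of "t0 - d"] r_pos[of "t0 - d"] d t0_pos by auto
  with r_t0 have "m \<noteq> t0" by auto
  with m d t0_pos have m': "0 < m" "m < t0" "t0 - m \<le> d" "t0 / 2 \<le> m" by auto
  have I1: "((\<lambda>s. (m - s) powr (\<gamma> - 1) * r s) has_integral (m powr (\<gamma> - 1) - Gamma \<gamma> * r m)) {0..m}"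
    using conv m' by simp
  define J where "J = (\<lambda>s. (t0 - s) powr (\<gamma> - 1) * r s)"
  have I0: "(J has_integral (t0 powr (\<gamma> - 1) - Gamma \<gamma> * r t0)) {0..t0}"
    using conv t0_pos unfolding J_def by simp
  hence J_int: "J integrable_on {0..t0}" by blast
  have J1: "J integrable_on {0..m}" "J integrable_on {m..t0}"
    using m' by (auto intro: integrable_subinterval_real[OF J_int])
  have J_split: "integral {0..m} J + integral {m..t0} J = t0 powr (\<gamma> - 1) - Gamma \<gamma> * r t0"
    using Henstock_Kurzweil_Integration.integral_combine[OF _ _ J_int, of m] m' integral_unique[OF I0] by simp
  \<comment> \<open>Since \<rho> m^(\<gamma>-1) = t0^(\<gamma>-1), the inhomogeneous terms of the
    equation at t0 and of \<rho> times the equation at m cancel.\<close>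
  define \<rho> where "\<rho> = (t0 / m) powr (\<gamma> - 1)"
  have \<rho>_pos: "\<rho> > 0" unfolding \<rho>_def using m' t0_pos by simp
  \<comment> \<open>At s = m the convention \<open>0 powr x = 0\<close> makes the kernel vanish
    while \<open>J m\<close> is positive. Changing this one value makes the pointwise comparison
    valid on all of [0,m] and leaves the integral as it was.\<close>
  define K where "K = (\<lambda>s. if s = m then J m / \<rho> else (m - s) powr (\<gamma> - 1) * r s)"
  have I1': "(K has_integral (m powr (\<gamma> - 1) - Gamma \<gamma> * r m)) {0..m}"
    by (rule has_integral_spike_finite[OF _ _ I1, of "{m}"]) (auto simp: K_def)
  have "integral {0..m} J \<le> \<rho> * (m powr (\<gamma> - 1) - Gamma \<gamma> * r m)"
  proof (rule has_integral_le[OF integrable_integral[OF J1(1)] has_integral_mult_right[OF I1']])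
    fix s assume s: "s \<in> {0..m}"
    show "J s \<le> \<rho> * K s"
    proof (cases "s = m")
      case True
      thus ?thesis using \<rho>_pos by (simp add: K_def)
    next
      case False
      have "(t0 - s) powr (\<gamma> - 1) \<le> ((t0 / m) * (m - s)) powr (\<gamma> - 1)"
      proof (rule powr_mono2')
        have "s * m \<le> s * t0" using s m' by (intro mult_left_mono) auto
        thus "t0 / m * (m - s) \<le> t0 - s" using m' by (simp add: field_simps)
      qed (use False s m' \<gamma> in auto)
      also have "\<dots> = \<rho> * (m - s) powr (\<gamma> - 1)"
        unfolding \<rho>_def using s m' by (subst powr_mult) auto
      finally have "J s \<le> \<rho> * (m - s) powr (\<gamma> - 1) * r s"
        unfolding J_def using r_nonneg[of s] s m' by (intro mult_right_mono) auto
      thus ?thesis using False by (simp add: K_def)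
    qed
  qed
  moreover have "integral {m..t0} J \<le> r m * ((t0 - m) powr \<gamma> / \<gamma>)"
  proof (rule has_integral_le[OF integrable_integral[OF J1(2)] has_integral_mult_right])
    have "((\<lambda>x. x powr (\<gamma> - 1)) has_integral (t0 - m) powr \<gamma> / \<gamma>) (cbox 0 (t0 - m))"
      using has_integral_powr_from_0[of "\<gamma> - 1" "t0 - m"] \<gamma> m' by simp
    from has_integral_affinity[OF this, of "-1" t0]
    show "((\<lambda>s. (t0 - s) powr (\<gamma> - 1)) has_integral (t0 - m) powr \<gamma> / \<gamma>) {m..t0}"
      using m' by simp
    fix s assume "s \<in> {m..t0}"
    thus "J s \<le> r m * (t0 - s) powr (\<gamma> - 1)"
      unfolding J_def using m(2)[of s] m m'
      by (subst mult.commute) (intro mult_right_mono; simp)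
  qed
  moreover have "\<rho> * m powr (\<gamma> - 1) = t0 powr (\<gamma> - 1)"
    unfolding \<rho>_def using m' t0_pos by (simp add: powr_divide)
  moreover have "Gamma \<gamma> * r t0 \<le> 0" using r_t0 Gp by (simp add: mult_nonneg_nonpos)
  \<comment> \<open>After the cancellation, \<rho> Gamma \<gamma> r(m) must be made up for by the
    integral over [m,t0] alone.\<close>
  ultimately have "r m * (\<rho> * Gamma \<gamma>) \<le> r m * ((t0 - m) powr \<gamma> / \<gamma>)"
    using J_split by (simp add: algebra_simps)
  hence "\<rho> * Gamma \<gamma> \<le> (t0 - m) powr \<gamma> / \<gamma>" by (simp only: mult_le_cancel_left_pos[OF \<open>r m > 0\<close>])
  also have "\<dots> \<le> d powr \<gamma> / \<gamma>" using \<gamma> m' by (intro divide_right_mono powr_mono2) auto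
  also have "\<dots> \<le> Gamma \<gamma> / 4" using d_powr \<gamma> by (simp add: field_simps)
  finally have "\<rho> \<le> 1 / 4" using Gp by (simp add: field_simps)
  moreover have "\<rho> \<ge> 1 / 2"
  proof -
    have "(2::real) powr (-1) \<le> 2 powr (\<gamma> - 1)" using \<gamma> by (intro powr_mono) auto
    also have "\<dots> \<le> \<rho>" unfolding \<rho>_def using m' \<gamma> t0_pos by (intro powr_mono2') (auto simp: field_simps)
    finally show ?thesis by (simp add: powr_minus)
  qed
  ultimately show False by simp
qed

text \<open>
  With \<open>x = t\<^sup>\<gamma>\<close> and \<open>r\<close> as above, \<open>f = E\<^bsub>\<gamma>,1\<^esub>(-t\<^sup>\<gamma>)\<close> satisfies \<open>1 - f = \<integral>\<^sub>0\<^sup>t r(s) ds\<close> and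
  \<open>\<Gamma>(1 - \<gamma>) f = \<integral>\<^sub>0\<^sup>t (t - s)\<^sup>-\<^sup>\<gamma> r(s) ds \<ge> t\<^sup>-\<^sup>\<gamma> (1 - f)\<close>, because \<open>r\<close> is nonnegative.
\<close>

lemma mittag_leffler_lower_bound:
  assumes \<gamma>: "0 < \<gamma>" "\<gamma> < 1" and "x \<ge> 0"
  shows "1 / (1 + Gamma (1 - \<gamma>) * x) \<le> mittag_leffler \<gamma> (- x)"
proof (cases "x = 0")
  case True
  have "mittag_leffler \<gamma> (- x) = mittag_leffler2 \<gamma> 1 0"
    using True by (simp add: mittag_leffler_def mittag_leffler2_def)
  thus ?thesis using True by (simp add: mittag_leffler2_0)
next
  case False
  define t where "t = x powr (1 / \<gamma>)"
  have t: "t > 0" "t powr \<gamma> = x" using assms False by (auto simp: t_def powr_powr)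
  define f where "f = mittag_leffler \<gamma> (- x)"
  have f: "f = mittag_leffler2 \<gamma> 1 (- x)"
    by (simp add: f_def mittag_leffler_def mittag_leffler2_def)
  define r where "r = (\<lambda>s. s powr (\<gamma> - 1) * mittag_leffler2 \<gamma> \<gamma> (- (s powr \<gamma>)))"
  have r_nonneg: "r s \<ge> 0" if "s \<ge> 0" for s
    using mittag_leffler2_pos[OF \<gamma>, of s] that by (cases "s = 0") (auto simp: r_def intro!: mult_nonneg_nonneg less_imp_le)
  have shift: "f = 1 - x * mittag_leffler2 \<gamma> (\<gamma> + 1) (- x)"
    unfolding f using mittag_leffler2_shift[OF \<gamma>(1), of 1 "- x"] by simp
  \<comment> \<open>Order a = 1 is ordinary integration. The kernel is written as a zeroth power,
    which is 1 except for the value 0 at s = t; there the kernel of order 1 - \<gamma> vanishes too,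
    so the comparison below survives.\<close>
  have "((\<lambda>s. (t - s) powr (1 - 1) * r s) has_integral
     (Gamma 1 * t powr (1 + \<gamma> - 1) * mittag_leffler2 \<gamma> (1 + \<gamma>) (- (t powr \<gamma>)))) {0..t}"
    unfolding r_def using \<gamma> t by (intro has_integral_mittag_leffler2_convolution) auto
  hence I1: "((\<lambda>s. (t - s) powr (1 - 1) * r s) has_integral (1 - f)) {0..t}"
    using shift t by (simp add: add.commute)
  \<comment> \<open>Order a = 1 - \<gamma> makes a + b = 1, so the power of t disappears and
    E_{\<gamma>,1} itself remains.\<close>
  have "((\<lambda>s. (t - s) powr ((1 - \<gamma>) - 1) * r s) has_integral
     (Gamma (1 - \<gamma>) * t powr ((1 - \<gamma>) + \<gamma> - 1) * mittag_leffler2 \<gamma> ((1 - \<gamma>) + \<gamma>) (- (t powr \<gamma>)))) {0..t}"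
    unfolding r_def using \<gamma> t by (intro has_integral_mittag_leffler2_convolution) auto
  hence I2: "((\<lambda>s. (t - s) powr (- \<gamma>) * r s) has_integral (Gamma (1 - \<gamma>) * f)) {0..t}"
    using t f by simp
  have "t powr (- \<gamma>) * (1 - f) \<le> Gamma (1 - \<gamma>) * f"
  proof (rule has_integral_le[OF has_integral_mult_right[OF I1] I2])
    fix s assume s: "s \<in> {0..t}"
    show "t powr - \<gamma> * ((t - s) powr (1 - 1) * r s) \<le> (t - s) powr - \<gamma> * r s"
    proof (cases "s = t")
      case False
      hence "t powr - \<gamma> \<le> (t - s) powr - \<gamma>" using s \<gamma> by (intro powr_mono2') auto
      thus ?thesis using False r_nonneg[of s] s by (simp add: mult_right_mono)
    qed simp
  qed
  hence "(1 - f) / x \<le> Gamma (1 - \<gamma>) * f" using t by (simp add: powr_minus divide_inverse mult.commute)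
  moreover have "x > 0" using False assms by simp
  ultimately have "1 - f \<le> Gamma (1 - \<gamma>) * x * f" by (simp add: pos_divide_le_eq mult_ac)
  moreover have "1 + Gamma (1 - \<gamma>) * x > 0"
    using \<gamma> assms Gamma_real_pos[of "1 - \<gamma>"] by (intro add_pos_nonneg mult_nonneg_nonneg) auto
  ultimately show ?thesis unfolding f_def[symmetric] by (simp add: field_simps)
qed

section \<open>The Fourier transform on \<open>L\<^sup>2\<close>\<close>

lemma gaussian_fourier_1d:
  fixes \<epsilon> a :: real
  assumes "\<epsilon> > 0"
  shows "integrable lborel (\<lambda>s. exp (- (\<epsilon> * s\<^sup>2 / 2)))"
    and "(LINT s|lborel. complex_of_real (exp (- (\<epsilon> * s\<^sup>2 / 2))) * exp (- \<i> * of_real (s * a))) =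
         of_real (sqrt (2 * pi / \<epsilon>) * exp (- (a\<^sup>2 / (2 * \<epsilon>))))"
proof -
  have n: "std_normal_density (sqrt \<epsilon> * s) = exp (- (\<epsilon> * s\<^sup>2 / 2)) / sqrt (2 * pi)" for s
    using assms by (simp add: std_normal_density_def power_mult_distrib)
  have "integrable lborel std_normal_density" by simp
  hence "integrable lborel (\<lambda>s. std_normal_density (0 + sqrt \<epsilon> * s))"
    using assms by (intro lborel_integrable_real_affine) auto
  hence "integrable lborel (\<lambda>s. sqrt (2 * pi) * std_normal_density (sqrt \<epsilon> * s))"
    by (intro integrable_mult_right) simp
  thus "integrable lborel (\<lambda>s. exp (- (\<epsilon> * s\<^sup>2 / 2)))"
    by (simp add: n)
  \<comment> \<open>The formula is the characteristic function of the standard normal law at b,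
    after the substitution x = sqrt(\<epsilon>) s, under which b x = - s a.\<close>
  define b where "b = - (a / sqrt \<epsilon>)"
  have "complex_of_real (exp (- (b\<^sup>2) / 2)) = (LINT x|std_normal_distribution. iexp (b * x))"
    using fun_cong[OF char_std_normal_distribution, of b] by (simp add: char_def)
  also have "\<dots> = (LINT x|lborel. std_normal_density x *\<^sub>R iexp (b * x))"
    by (subst integral_density) auto
  also have "\<dots> = sqrt \<epsilon> *\<^sub>R (LINT s|lborel. std_normal_density (0 + sqrt \<epsilon> * s) *\<^sub>R iexp (b * (0 + sqrt \<epsilon> * s)))"
    using assms by (subst lborel_integral_real_affine[where c = "sqrt \<epsilon>" and t = 0]) auto
  also have "(\<lambda>s. std_normal_density (0 + sqrt \<epsilon> * s) *\<^sub>R iexp (b * (0 + sqrt \<epsilon> * s))) =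
     (\<lambda>s. complex_of_real (1 / sqrt (2 * pi)) *
        (complex_of_real (exp (- (\<epsilon> * s\<^sup>2 / 2))) * exp (- \<i> * of_real (s * a))))"
    using assms unfolding add_0 n by (intro ext) (simp add: b_def scaleR_conv_of_real mult_ac)
  also have "sqrt \<epsilon> *\<^sub>R (LINT s|lborel. complex_of_real (1 / sqrt (2 * pi)) *
        (complex_of_real (exp (- (\<epsilon> * s\<^sup>2 / 2))) * exp (- \<i> * of_real (s * a)))) =
     complex_of_real (sqrt \<epsilon> / sqrt (2 * pi)) * 
     (LINT s|lborel. complex_of_real (exp (- (\<epsilon> * s\<^sup>2 / 2))) * exp (- \<i> * of_real (s * a)))"
    by (subst integral_mult_right_zero) (simp add: scaleR_conv_of_real)
  finally have e: "complex_of_real (exp (- (b\<^sup>2) / 2)) = complex_of_real (sqrt \<epsilon> / sqrt (2 * pi)) * 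
     (LINT s|lborel. complex_of_real (exp (- (\<epsilon> * s\<^sup>2 / 2))) * exp (- \<i> * of_real (s * a)))" .
  have b: "- (b\<^sup>2) / 2 = - (a\<^sup>2 / (2 * \<epsilon>))"
    using assms by (simp add: b_def power_divide)
  have "complex_of_real (sqrt (2 * pi / \<epsilon>)) * complex_of_real (exp (- (b\<^sup>2) / 2)) =
     (complex_of_real (sqrt (2 * pi / \<epsilon>)) * complex_of_real (sqrt \<epsilon> / sqrt (2 * pi))) * 
     (LINT s|lborel. complex_of_real (exp (- (\<epsilon> * s\<^sup>2 / 2))) * exp (- \<i> * of_real (s * a)))"
    unfolding e by (simp only: mult.assoc)
  also have "complex_of_real (sqrt (2 * pi / \<epsilon>)) * complex_of_real (sqrt \<epsilon> / sqrt (2 * pi)) = 1"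
    using assms unfolding of_real_mult[symmetric] real_sqrt_divide by simp
  finally show "(LINT s|lborel. complex_of_real (exp (- (\<epsilon> * s\<^sup>2 / 2))) * exp (- \<i> * of_real (s * a))) =
         of_real (sqrt (2 * pi / \<epsilon>) * exp (- (a\<^sup>2 / (2 * \<epsilon>))))"
    unfolding b by simp
qed

text \<open>\<open>lborel\<close> is the image of the product of one-dimensional Lebesgue measures
  under the coordinate map, so integrands that factor over \<open>Basis\<close> separate.\<close>

lemma lborel_integral_prod:
  fixes f :: "'a::euclidean_space \<Rightarrow> real \<Rightarrow> 'b::{real_normed_field,banach,second_countable_topology}"
  assumes "\<And>b. b \<in> Basis \<Longrightarrow> integrable lborel (f b)"
  shows "integrable lborel (\<lambda>x::'a. \<Prod>b\<in>Basis. f b (x \<bullet> b))"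
    and "(LINT x|lborel. (\<Prod>b\<in>Basis. f b (x \<bullet> b))) = (\<Prod>b\<in>Basis. LINT s|lborel. f b s)"
proof -
  interpret product_sigma_finite "\<lambda>_::'a. lborel :: real measure" by standard
  have [measurable]: "f b \<in> borel_measurable borel" if "b \<in> Basis" for b
    using borel_measurable_integrable[OF assms[OF that]] by simp
  have p: "(\<Prod>b\<in>Basis. f b ((\<Sum>c\<in>Basis. y c *\<^sub>R c) \<bullet> b)) = (\<Prod>b\<in>Basis. f b (y b))" for y :: "'a \<Rightarrow> real"
    by (intro prod.cong) auto
  have meas: "(\<lambda>x::'a. \<Prod>b\<in>Basis. f b (x \<bullet> b)) \<in> borel_measurable borel"
    by measurable
  have meas2: "(\<lambda>y::'a\<Rightarrow>real. \<Sum>b\<in>Basis. y b *\<^sub>R b) \<in> measurable (\<Pi>\<^sub>M b\<in>Basis. lborel) borel"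
    by measurable
  have "integrable (\<Pi>\<^sub>M b\<in>Basis. lborel) (\<lambda>y. \<Prod>b\<in>Basis. f b (y b))"
    using assms by (intro product_integrable_prod) auto
  thus "integrable lborel (\<lambda>x::'a. \<Prod>b\<in>Basis. f b (x \<bullet> b))"
    by (subst lborel_eq, subst integrable_distr_eq[OF meas2 meas]) (simp only: p)
  show "(LINT x|lborel. (\<Prod>b\<in>Basis. f b (x \<bullet> b))) = (\<Prod>b\<in>Basis. LINT s|lborel. f b s)"
    by (subst lborel_eq, subst integral_distr[OF meas2 meas])
      (simp only: p product_integral_prod[OF finite_Basis assms])
qed

lemma gaussian_fourier:
  fixes \<epsilon> :: real and z :: "'a::euclidean_space"
  assumes "\<epsilon> > 0"
  shows "integrable lborel (\<lambda>\<xi>::'a. exp (- (\<epsilon> * (norm \<xi>)\<^sup>2 / 2)))"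
    and "(LINT \<xi>|lborel. complex_of_real (exp (- (\<epsilon> * (norm \<xi>)\<^sup>2 / 2))) * exp (- \<i> * of_real (\<xi> \<bullet> z))) =
         of_real ((2 * pi / \<epsilon>) powr (real DIM('a) / 2) * exp (- ((norm z)\<^sup>2 / (2 * \<epsilon>))))"
proof -
  have norm: "(norm x)\<^sup>2 = (\<Sum>b\<in>Basis. (x \<bullet> b)\<^sup>2)" for x :: 'a
    unfolding power2_norm_eq_inner by (subst euclidean_inner) (simp add: power2_eq_square)
  have exp1: "exp (- (\<epsilon> * (norm \<xi>)\<^sup>2 / 2)) = (\<Prod>b\<in>Basis. exp (- (\<epsilon> * (\<xi> \<bullet> b)\<^sup>2 / 2)))" for \<xi> :: 'a
    unfolding norm by (simp add: exp_sum[symmetric] sum_negf sum_distrib_left sum_divide_distrib)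
  have exp2: "exp (- \<i> * of_real (\<xi> \<bullet> z)) = (\<Prod>b\<in>Basis. exp (- \<i> * of_real ((\<xi> \<bullet> b) * (z \<bullet> b))))" for \<xi>
    by (subst euclidean_inner) (simp add: exp_sum[symmetric] sum_negf sum_distrib_left)
  show "integrable lborel (\<lambda>\<xi>::'a. exp (- (\<epsilon> * (norm \<xi>)\<^sup>2 / 2)))"
    unfolding exp1 by (intro lborel_integral_prod gaussian_fourier_1d assms)
  have int: "integrable lborel (\<lambda>s. complex_of_real (exp (- (\<epsilon> * s\<^sup>2 / 2))) * exp (- \<i> * of_real (s * a)))" for a
    by (rule Bochner_Integration.integrable_bound[OF gaussian_fourier_1d(1)[OF assms]])
      (auto simp: norm_mult)
  have "(LINT \<xi>|lborel. complex_of_real (exp (- (\<epsilon> * (norm \<xi>)\<^sup>2 / 2))) * exp (- \<i> * of_real (\<xi> \<bullet> z))) =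
    (LINT \<xi>|lborel. (\<Prod>b\<in>Basis. complex_of_real (exp (- (\<epsilon> * (\<xi> \<bullet> b)\<^sup>2 / 2))) *
        exp (- \<i> * of_real ((\<xi> \<bullet> b) * (z \<bullet> b)))))"
    unfolding exp1 exp2 of_real_prod prod.distrib ..
  also have "\<dots> = (\<Prod>b\<in>Basis. of_real (sqrt (2 * pi / \<epsilon>) * exp (- ((z \<bullet> b)\<^sup>2 / (2 * \<epsilon>)))))"
    by (subst lborel_integral_prod(2)[OF int]) (simp only: gaussian_fourier_1d(2)[OF assms])
  also have "\<dots> = of_real (sqrt (2 * pi / \<epsilon>) ^ DIM('a) * exp (- ((norm z)\<^sup>2 / (2 * \<epsilon>))))"
    unfolding of_real_prod[symmetric] prod.distrib prod_constant norm
    by (simp add: exp_sum[symmetric] sum_negf sum_divide_distrib)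
  also have "sqrt (2 * pi / \<epsilon>) ^ DIM('a) = (2 * pi / \<epsilon>) powr (real DIM('a) / 2)"
    using assms by (simp add: powr_half_sqrt[symmetric] powr_realpow[symmetric] powr_powr)
  finally show "(LINT \<xi>|lborel. complex_of_real (exp (- (\<epsilon> * (norm \<xi>)\<^sup>2 / 2))) * exp (- \<i> * of_real (\<xi> \<bullet> z))) =
         of_real ((2 * pi / \<epsilon>) powr (real DIM('a) / 2) * exp (- ((norm z)\<^sup>2 / (2 * \<epsilon>))))" .
qed

lemma nn_integral_gaussian:
  fixes \<epsilon> :: real and y :: "'a::euclidean_space"
  assumes "\<epsilon> > 0"
  shows "(\<integral>\<^sup>+x. ennreal (exp (- ((norm (x - y))\<^sup>2 / (2 * \<epsilon>)))) \<partial>lborel) =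
    ennreal ((2 * pi * \<epsilon>) powr (real DIM('a) / 2))"
proof -
  have e: "(norm x)\<^sup>2 / (2 * \<epsilon>) = (1 / \<epsilon>) * (norm x)\<^sup>2 / 2" for x :: 'a by simp
  have int: "integrable lborel (\<lambda>x::'a. exp (- ((norm x)\<^sup>2 / (2 * \<epsilon>))))"
    unfolding e using assms by (intro gaussian_fourier) auto
  have "complex_of_real (LINT x|lborel. exp (- ((norm (x::'a))\<^sup>2 / (2 * \<epsilon>)))) =
      (LINT x|lborel. complex_of_real (exp (- ((1 / \<epsilon>) * (norm (x::'a))\<^sup>2 / 2))) * exp (- \<i> * of_real (x \<bullet> 0)))"
    unfolding integral_complex_of_real[symmetric] e by simp
  also have "\<dots> = of_real ((2 * pi * \<epsilon>) powr (real DIM('a) / 2))"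
    using assms by (subst gaussian_fourier(2)) auto
  finally have I: "(LINT x|lborel. exp (- ((norm (x::'a))\<^sup>2 / (2 * \<epsilon>)))) = (2 * pi * \<epsilon>) powr (real DIM('a) / 2)"
    unfolding of_real_eq_iff .
  have "(\<integral>\<^sup>+x. ennreal (exp (- ((norm (x - y))\<^sup>2 / (2 * \<epsilon>)))) \<partial>lborel) =
    (\<integral>\<^sup>+x. ennreal (exp (- ((norm (y + x - y))\<^sup>2 / (2 * \<epsilon>)))) \<partial>lborel)"
    by (subst lborel_distr_plus[symmetric, of y], subst nn_integral_distr) auto
  also have "\<dots> = ennreal (LINT x|lborel. exp (- ((norm (x::'a))\<^sup>2 / (2 * \<epsilon>))))"
    using int by (simp add: nn_integral_eq_integral)
  finally show ?thesis unfolding I .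
qed

section \<open>Bessel's inequality for integrable functions\<close>

lemma ennreal_norm_integral_le:
  fixes f :: "'a \<Rightarrow> 'b::{banach, second_countable_topology}"
  shows "ennreal (norm (integral\<^sup>L M f)) \<le> (\<integral>\<^sup>+x. ennreal (norm (f x)) \<partial>M)"
  \<comment> \<open>A non-integrable f has Bochner integral 0, so the bound can later be applied
    under an outer integral without an integrability check.\<close>
  by (cases "integrable M f") (auto simp: integral_norm_bound_ennreal not_integrable_integral_eq)

lemma integrable_exp_kernel:
  fixes f :: "'a::euclidean_space \<Rightarrow> complex"
  assumes "integrable lborel f"
  shows "integrable lborel (\<lambda>x. f x * exp (- \<i> * of_real (x \<bullet> \<xi>)))"
proof -
  have [measurable]: "f \<in> borel_measurable borel" using borel_measurable_integrable[OF assms] by simp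
  show ?thesis
    by (rule Bochner_Integration.integrable_bound[OF integrable_norm[OF assms]]) (simp_all add: norm_mult)
qed

lemma lborel_pair_integrable_mult:
  fixes f :: "'a::euclidean_space \<Rightarrow> real" and g :: "'b::euclidean_space \<Rightarrow> real"
  assumes f: "integrable lborel f" and g: "integrable lborel g"
  shows "integrable (lborel \<Otimes>\<^sub>M lborel) (\<lambda>(x, y). f x * g y)"
proof -
  have [measurable]: "f \<in> borel_measurable borel" "g \<in> borel_measurable borel"
    using borel_measurable_integrable[OF f] borel_measurable_integrable[OF g] by auto
  show ?thesis
  proof (rule lborel_pair.Fubini_integrable)
    show "(\<lambda>(x, y). f x * g y) \<in> borel_measurable (lborel \<Otimes>\<^sub>M lborel)" by measurable
    show "integrable lborel (\<lambda>x. LINT y|lborel. norm (case (x, y) of (x, y) \<Rightarrow> f x * g y))"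
      using f g by (simp add: abs_mult)
    show "AE x in lborel. integrable lborel (\<lambda>y. case (x, y) of (x, y) \<Rightarrow> f x * g y)"
      using g by simp
  qed
qed

lemma fourier_integral_measurable [measurable]:
  assumes [measurable]: "f \<in> borel_measurable borel"
  shows "fourier_integral f \<in> borel_measurable borel"
  unfolding fourier_integral_def[abs_def] by measurable

text \<open>
  By Fubini the left-hand side is a double integral of \<open>f x * cnj (f y)\<close> against a Gaussian in \<open>x - y\<close>;
  bound \<open>2 |f x| |f y|\<close> by \<open>|f x|\<^sup>2 + |f y|\<^sup>2\<close>.
\<close>

lemma bessel_gaussian:
  fixes f :: "'a::euclidean_space \<Rightarrow> complex"
  assumes f: "integrable lborel f" and "\<epsilon> > 0"
  defines "H \<equiv> (\<lambda>\<xi>. LINT x|lborel. f x * exp (- \<i> * of_real (x \<bullet> \<xi>)))"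
  shows "(\<integral>\<^sup>+\<xi>. ennreal ((norm (H \<xi>))\<^sup>2 * exp (- (\<epsilon> * (norm \<xi>)\<^sup>2 / 2))) \<partial>lborel)
     \<le> ennreal ((2 * pi) powr real DIM('a)) * (\<integral>\<^sup>+x. ennreal ((norm (f x))\<^sup>2) \<partial>lborel)"
proof -
  have f_meas [measurable]: "f \<in> borel_measurable borel" using borel_measurable_integrable[OF f] by simp
  have cnj_meas [measurable]: "(\<lambda>x. cnj (f x)) \<in> borel_measurable borel"
    by (rule measurable_compose[OF f_meas]) (intro borel_measurable_continuous_onI continuous_intros)
  have H_meas [measurable]: "H \<in> borel_measurable borel" unfolding H_def by measurable
  define \<phi> :: "'a \<Rightarrow> real" where "\<phi> = (\<lambda>\<xi>. exp (- (\<epsilon> * (norm \<xi>)\<^sup>2 / 2)))"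
  have \<phi>_meas [measurable]: "\<phi> \<in> borel_measurable borel" unfolding \<phi>_def by measurable
  have \<phi>_int: "integrable lborel \<phi>" unfolding \<phi>_def by (rule gaussian_fourier(1)[OF \<open>\<epsilon> > 0\<close>])
  have \<phi>_pos: "\<phi> \<xi> \<ge> 0" for \<xi> by (simp add: \<phi>_def)
  define c where "c = (2 * pi / \<epsilon>) powr (real DIM('a) / 2)"
  define G :: "'a \<Rightarrow> real" where "G = (\<lambda>z. exp (- ((norm z)\<^sup>2 / (2 * \<epsilon>))))"
  have G_meas [measurable]: "G \<in> borel_measurable borel" unfolding G_def by measurable
  have c_nonneg: "c \<ge> 0" by (simp add: c_def)
  have G_pos: "G z \<ge> 0" for z by (simp add: G_def)
  define N where "N = (LINT x|lborel. norm (f x))"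
  have H_bound: "norm (H \<xi>) \<le> N" for \<xi>
    unfolding H_def N_def by (rule order_trans[OF integral_norm_bound]) (simp add: norm_mult)
  have N: "N \<ge> 0" unfolding N_def by simp
  have H_cnj: "cnj (H \<xi>) = (LINT y|lborel. cnj (f y) * exp (\<i> * of_real (y \<bullet> \<xi>)))" for \<xi>
  proof -
    have e: "cnj (f y * exp (- \<i> * of_real (y \<bullet> \<xi>))) = cnj (f y) * exp (\<i> * of_real (y \<bullet> \<xi>))" for y
      by (simp add: exp_cnj)
    have "(LINT y|lborel. cnj (f y) * exp (\<i> * of_real (y \<bullet> \<xi>))) =
       (LINT y|lborel. cnj (f y * exp (- \<i> * of_real (y \<bullet> \<xi>))))" unfolding e ..
    thus ?thesis by (simp only: H_def Bochner_Integration.integral_cnj)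
  qed
  \<comment> \<open>H is only known to be bounded; the Gaussian weight is what makes both double
    integrals absolutely convergent and Fubini applicable.\<close>
  have int1: "integrable (lborel \<Otimes>\<^sub>M lborel)
     (\<lambda>(\<xi>, y). H \<xi> * of_real (\<phi> \<xi>) * (cnj (f y) * exp (\<i> * of_real (y \<bullet> \<xi>))))"
  proof (rule Bochner_Integration.integrable_bound)
    show "integrable (lborel \<Otimes>\<^sub>M lborel) (\<lambda>(\<xi>, y). (N * \<phi> \<xi>) * norm (f y))"
      by (intro lborel_pair_integrable_mult integrable_mult_right \<phi>_int integrable_norm f)
    show "AE z in lborel \<Otimes>\<^sub>M lborel.
       norm (case z of (\<xi>, y) \<Rightarrow> H \<xi> * of_real (\<phi> \<xi>) * (cnj (f y) * exp (\<i> * of_real (y \<bullet> \<xi>))))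
       \<le> norm (case z of (\<xi>, y) \<Rightarrow> (N * \<phi> \<xi>) * norm (f y))"
      using H_bound \<phi>_pos N by (intro AE_I2) (auto simp: norm_mult intro!: mult_right_mono)
  qed measurable
  have int2: "integrable (lborel \<Otimes>\<^sub>M lborel)
     (\<lambda>(x, \<xi>). f x * of_real (\<phi> \<xi>) * exp (- \<i> * of_real (\<xi> \<bullet> (x - y))))" for y
  proof (rule Bochner_Integration.integrable_bound)
    show "integrable (lborel \<Otimes>\<^sub>M lborel) (\<lambda>(x, \<xi>). norm (f x) * \<phi> \<xi>)"
      by (intro lborel_pair_integrable_mult \<phi>_int integrable_norm f)
    show "AE z in lborel \<Otimes>\<^sub>M lborel.
       norm (case z of (x, \<xi>) \<Rightarrow> f x * of_real (\<phi> \<xi>) * exp (- \<i> * of_real (\<xi> \<bullet> (x - y))))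
       \<le> norm (case z of (x, \<xi>) \<Rightarrow> norm (f x) * \<phi> \<xi>)"
      using \<phi>_pos by (intro AE_I2) (auto simp: norm_mult)
  qed measurable
  have inner: "(LINT \<xi>|lborel. H \<xi> * of_real (\<phi> \<xi>) * exp (\<i> * of_real (y \<bullet> \<xi>))) =
     (LINT x|lborel. f x * of_real (c * G (x - y)))" for y
  proof -
    have "(LINT \<xi>|lborel. H \<xi> * of_real (\<phi> \<xi>) * exp (\<i> * of_real (y \<bullet> \<xi>))) =
      (LINT \<xi>|lborel. LINT x|lborel. f x * of_real (\<phi> \<xi>) * exp (- \<i> * of_real (\<xi> \<bullet> (x - y))))"
    proof (rule Bochner_Integration.integral_cong[OF refl])
      fix \<xi> :: 'a
      have "f x * of_real (\<phi> \<xi>) * exp (- \<i> * of_real (\<xi> \<bullet> (x - y))) =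
        (f x * exp (- \<i> * of_real (x \<bullet> \<xi>))) * (of_real (\<phi> \<xi>) * exp (\<i> * of_real (y \<bullet> \<xi>)))" for x
      proof -
        have "exp (- \<i> * of_real (\<xi> \<bullet> (x - y))) = exp (- \<i> * of_real (x \<bullet> \<xi>)) * exp (\<i> * of_real (y \<bullet> \<xi>))"
          unfolding exp_add[symmetric] by (simp add: inner_diff_right inner_commute algebra_simps)
        thus ?thesis by (simp only: mult_ac)
      qed
      thus "H \<xi> * of_real (\<phi> \<xi>) * exp (\<i> * of_real (y \<bullet> \<xi>)) =
        (LINT x|lborel. f x * of_real (\<phi> \<xi>) * exp (- \<i> * of_real (\<xi> \<bullet> (x - y))))"
        unfolding H_def mult.assoc[of _ "of_real (\<phi> \<xi>)" "exp (\<i> * _)"]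
        by (simp only: Bochner_Integration.integral_mult_left_zero)
    qed
    also have "\<dots> = (LINT x|lborel. LINT \<xi>|lborel. f x * of_real (\<phi> \<xi>) * exp (- \<i> * of_real (\<xi> \<bullet> (x - y))))"
      by (rule lborel_pair.Fubini_integral[OF int2])
    also have "\<dots> = (LINT x|lborel. f x * of_real (c * G (x - y)))"
      unfolding mult.assoc integral_mult_right_zero \<phi>_def gaussian_fourier(2)[OF \<open>\<epsilon> > 0\<close>] c_def G_def ..
    finally show ?thesis .
  qed
  have "complex_of_real (LINT \<xi>|lborel. (norm (H \<xi>))\<^sup>2 * \<phi> \<xi>) =
     (LINT \<xi>|lborel. LINT y|lborel. H \<xi> * of_real (\<phi> \<xi>) * (cnj (f y) * exp (\<i> * of_real (y \<bullet> \<xi>))))"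
    unfolding integral_complex_of_real[symmetric]
  proof (rule Bochner_Integration.integral_cong[OF refl])
    fix \<xi>
    have "complex_of_real ((norm (H \<xi>))\<^sup>2 * \<phi> \<xi>) = H \<xi> * of_real (\<phi> \<xi>) * cnj (H \<xi>)"
      by (simp add: complex_norm_square[symmetric] mult_ac)
    thus "complex_of_real ((norm (H \<xi>))\<^sup>2 * \<phi> \<xi>) =
      (LINT y|lborel. H \<xi> * of_real (\<phi> \<xi>) * (cnj (f y) * exp (\<i> * of_real (y \<bullet> \<xi>))))"
      by (simp only: H_cnj integral_mult_right_zero)
  qed
  also have "\<dots> = (LINT y|lborel. LINT \<xi>|lborel. H \<xi> * of_real (\<phi> \<xi>) * (cnj (f y) * exp (\<i> * of_real (y \<bullet> \<xi>))))"
    by (rule lborel_pair.Fubini_integral[OF int1, symmetric])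
  also have "\<dots> = (LINT y|lborel. cnj (f y) * (LINT x|lborel. f x * of_real (c * G (x - y))))"
    unfolding inner[symmetric] integral_mult_right_zero[symmetric] by (simp add: mult_ac)
  finally have L: "complex_of_real (LINT \<xi>|lborel. (norm (H \<xi>))\<^sup>2 * \<phi> \<xi>) =
    (LINT y|lborel. cnj (f y) * (LINT x|lborel. f x * of_real (c * G (x - y))))" .
  have int3: "integrable lborel (\<lambda>\<xi>. (norm (H \<xi>))\<^sup>2 * \<phi> \<xi>)"
  proof (rule Bochner_Integration.integrable_bound)
    show "integrable lborel (\<lambda>\<xi>. N\<^sup>2 * \<phi> \<xi>)" using \<phi>_int by simp
    show "AE \<xi> in lborel. norm ((norm (H \<xi>))\<^sup>2 * \<phi> \<xi>) \<le> norm (N\<^sup>2 * \<phi> \<xi>)"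
      using H_bound \<phi>_pos by (intro AE_I2) (auto simp: intro!: mult_right_mono power_mono)
  qed measurable
  \<comment> \<open>From here on the estimate runs in the extended nonnegative reals, because f is
    integrable but possibly not square integrable.\<close>
  define Q where "Q = (\<lambda>x. ennreal ((norm (f x))\<^sup>2))"
  have Q_meas [measurable]: "Q \<in> borel_measurable borel" unfolding Q_def by measurable
  define S where "S = ennreal ((2 * pi * \<epsilon>) powr (real DIM('a) / 2))"
  have GS: "(\<integral>\<^sup>+x. ennreal (G (x - y)) \<partial>lborel) = S" "(\<integral>\<^sup>+x. ennreal (G (y - x)) \<partial>lborel) = S" for y
    using nn_integral_gaussian[OF \<open>\<epsilon> > 0\<close>, of y] unfolding G_def S_def
    by (simp_all add: norm_minus_commute)
  have "(\<integral>\<^sup>+\<xi>. ennreal ((norm (H \<xi>))\<^sup>2 * \<phi> \<xi>) \<partial>lborel) = ennreal (LINT \<xi>|lborel. (norm (H \<xi>))\<^sup>2 * \<phi> \<xi>)"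
    using \<phi>_pos by (intro nn_integral_eq_integral int3) auto
  also have "\<dots> = ennreal (norm (LINT y|lborel. cnj (f y) * (LINT x|lborel. f x * of_real (c * G (x - y)))))"
    unfolding L[symmetric] using \<phi>_pos by (simp add: integral_nonneg_AE)
  also have "\<dots> \<le> (\<integral>\<^sup>+y. ennreal (norm (cnj (f y) * (LINT x|lborel. f x * of_real (c * G (x - y))))) \<partial>lborel)"
    by (rule ennreal_norm_integral_le)
  also have "\<dots> = (\<integral>\<^sup>+y. ennreal (norm (f y)) * ennreal (norm (LINT x|lborel. f x * of_real (c * G (x - y)))) \<partial>lborel)"
    by (simp add: norm_mult ennreal_mult)
  also have "\<dots> \<le> (\<integral>\<^sup>+y. ennreal (norm (f y)) * (\<integral>\<^sup>+x. ennreal (norm (f x * of_real (c * G (x - y)))) \<partial>lborel) \<partial>lborel)"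
    by (intro nn_integral_mono mult_left_mono ennreal_norm_integral_le) auto
  also have "\<dots> = (\<integral>\<^sup>+y. (\<integral>\<^sup>+x. ennreal (norm (f y) * norm (f x * of_real (c * G (x - y)))) \<partial>lborel) \<partial>lborel)"
    by (subst nn_integral_cmult[symmetric]) (auto simp: ennreal_mult)
  also have "\<dots> \<le> (\<integral>\<^sup>+y. (\<integral>\<^sup>+x. ennreal (c / 2) * (Q x * ennreal (G (x - y)) + Q y * ennreal (G (x - y))) \<partial>lborel) \<partial>lborel)"
  proof (intro nn_integral_mono)
    fix x y :: 'a
    have "norm (f y) * norm (f x * of_real (c * G (x - y))) = (norm (f y) * norm (f x)) * (c * G (x - y))"
      using c_nonneg G_pos by (simp add: norm_mult)
    also have "\<dots> \<le> (((norm (f x))\<^sup>2 + (norm (f y))\<^sup>2) / 2) * (c * G (x - y))"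
      using c_nonneg G_pos sum_squares_bound[of "norm (f y)" "norm (f x)"]
      by (intro mult_right_mono) (auto simp: mult_nonneg_nonneg)
    also have "\<dots> = c / 2 * ((norm (f x))\<^sup>2 * G (x - y) + (norm (f y))\<^sup>2 * G (x - y))"
      by (simp add: algebra_simps)
    finally show "ennreal (norm (f y) * norm (f x * of_real (c * G (x - y)))) \<le>
       ennreal (c / 2) * (Q x * ennreal (G (x - y)) + Q y * ennreal (G (x - y)))"
      unfolding Q_def using c_nonneg G_pos
      by (simp add: ennreal_mult[symmetric] ennreal_plus[symmetric] ennreal_leI del: ennreal_plus)
  qed
  \<comment> \<open>Integrating the Gaussian first, in y for one summand and in x for the other,
    gives S times the integral of Q both times.\<close>
  also have "\<dots> = ennreal (c / 2) * ((\<integral>\<^sup>+y. (\<integral>\<^sup>+x. Q x * ennreal (G (x - y)) \<partial>lborel) \<partial>lborel) +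
     (\<integral>\<^sup>+y. (\<integral>\<^sup>+x. Q y * ennreal (G (x - y)) \<partial>lborel) \<partial>lborel))"
    by (simp add: nn_integral_cmult nn_integral_add)
  also have "(\<integral>\<^sup>+y. (\<integral>\<^sup>+x. Q x * ennreal (G (x - y)) \<partial>lborel) \<partial>lborel) =
     (\<integral>\<^sup>+x. (\<integral>\<^sup>+y. Q x * ennreal (G (x - y)) \<partial>lborel) \<partial>lborel)"
    by (rule lborel_pair.Fubini') measurable
  also have "\<dots> = (\<integral>\<^sup>+x. Q x \<partial>lborel) * S"
    by (simp add: nn_integral_cmult nn_integral_multc GS)
  also have "(\<integral>\<^sup>+y. (\<integral>\<^sup>+x. Q y * ennreal (G (x - y)) \<partial>lborel) \<partial>lborel) = (\<integral>\<^sup>+x. Q x \<partial>lborel) * S"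
    by (simp add: nn_integral_cmult nn_integral_multc GS)
  also have "ennreal (c / 2) * ((\<integral>\<^sup>+x. Q x \<partial>lborel) * S + (\<integral>\<^sup>+x. Q x \<partial>lborel) * S) =
     (ennreal (c / 2) * 2 * S) * (\<integral>\<^sup>+x. Q x \<partial>lborel)"
    by (simp add: mult_2[symmetric] mult_ac)
  also have "ennreal (c / 2) * 2 * S = ennreal (c / 2 * 2 * (2 * pi * \<epsilon>) powr (real DIM('a) / 2))"
    unfolding S_def using c_nonneg by (subst ennreal_mult, simp, simp, subst ennreal_mult) auto
  \<comment> \<open>The powers of \<epsilon> in c and S cancel, which is what allows \<epsilon> to
    tend to 0 afterwards.\<close>
  also have "c / 2 * 2 * (2 * pi * \<epsilon>) powr (real DIM('a) / 2) = ((2 * pi / \<epsilon>) * (2 * pi * \<epsilon>)) powr (real DIM('a) / 2)"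
    unfolding c_def using \<open>\<epsilon> > 0\<close> by (subst powr_mult) auto
  also have "(2 * pi / \<epsilon>) * (2 * pi * \<epsilon>) = (2 * pi) powr 2"
    using \<open>\<epsilon> > 0\<close> by (simp add: power2_eq_square)
  also have "((2 * pi) powr 2) powr (real DIM('a) / 2) = (2 * pi) powr real DIM('a)"
    unfolding powr_powr by simp
  finally show ?thesis unfolding Q_def \<phi>_def .
qed

text \<open>Fatou's lemma removes the Gaussian weight along \<epsilon> = 1/(k+1), and the squared
  normalization (2 pi)^(-n) cancels the constant (2 pi)^n exactly.\<close>

lemma bessel_fourier_integral:
  fixes f :: "'a::euclidean_space \<Rightarrow> complex"
  assumes f: "integrable lborel f"
  shows "(\<integral>\<^sup>+\<xi>. ennreal ((norm (fourier_integral f \<xi>))\<^sup>2) \<partial>lborel)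
     \<le> (\<integral>\<^sup>+x. ennreal ((norm (f x))\<^sup>2) \<partial>lborel)"
proof -
  have [measurable]: "f \<in> borel_measurable borel" using borel_measurable_integrable[OF f] by simp
  define H where "H = (\<lambda>\<xi>. LINT x|lborel. f x * exp (- \<i> * of_real (x \<bullet> \<xi>)))"
  have [measurable]: "H \<in> borel_measurable borel" unfolding H_def by measurable
  define u where "u = (\<lambda>k \<xi>. ennreal ((norm (H \<xi>))\<^sup>2 * exp (- (1 / real (Suc k) * (norm \<xi>)\<^sup>2 / 2))))"
  define B where "B = ennreal ((2 * pi) powr real DIM('a)) * (\<integral>\<^sup>+x. ennreal ((norm (f x))\<^sup>2) \<partial>lborel)"
  have uB: "(\<integral>\<^sup>+\<xi>. u k \<xi> \<partial>lborel) \<le> B" for k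
    unfolding u_def B_def H_def by (rule bessel_gaussian[OF f]) simp
  have lim: "(\<lambda>k. u k \<xi>) \<longlonglongrightarrow> ennreal ((norm (H \<xi>))\<^sup>2)" for \<xi>
  proof -
    have "(\<lambda>k. (norm (H \<xi>))\<^sup>2 * exp (- (1 / real (Suc k) * (norm \<xi>)\<^sup>2 / 2))) \<longlonglongrightarrow> (norm (H \<xi>))\<^sup>2 * exp (- (0 * (norm \<xi>)\<^sup>2 / 2))"
      by (intro tendsto_intros LIMSEQ_Suc[OF lim_1_over_n]) auto
    thus ?thesis unfolding u_def by (intro tendsto_ennrealI) simp
  qed
  have "(\<integral>\<^sup>+\<xi>. ennreal ((norm (H \<xi>))\<^sup>2) \<partial>lborel) = (\<integral>\<^sup>+\<xi>. liminf (\<lambda>k. u k \<xi>) \<partial>lborel)"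
    using lim_imp_Liminf[OF _ lim] by (intro nn_integral_cong) simp
  also have "\<dots> \<le> liminf (\<lambda>k. \<integral>\<^sup>+\<xi>. u k \<xi> \<partial>lborel)"
    unfolding u_def by (intro nn_integral_liminf) measurable
  also have "\<dots> \<le> B"
    using Liminf_mono[of "\<lambda>k. \<integral>\<^sup>+\<xi>. u k \<xi> \<partial>lborel" "\<lambda>_. B" sequentially] uB
    by (simp add: Liminf_const)
  finally have HB: "(\<integral>\<^sup>+\<xi>. ennreal ((norm (H \<xi>))\<^sup>2) \<partial>lborel) \<le> B" .
  define c where "c = (2 * pi) powr (- real DIM('a) / 2)"
  have c2: "c\<^sup>2 = (2 * pi) powr (- real DIM('a))"
    unfolding c_def by (simp add: powr_powr[symmetric] powr_realpow[symmetric] powr_powr)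
  have "(norm (fourier_integral f \<xi>))\<^sup>2 = c\<^sup>2 * (norm (H \<xi>))\<^sup>2" for \<xi>
    by (simp only: fourier_integral_def H_def c_def norm_mult power_mult_distrib norm_of_real power2_abs)
  hence "(\<integral>\<^sup>+\<xi>. ennreal ((norm (fourier_integral f \<xi>))\<^sup>2) \<partial>lborel) =
     (\<integral>\<^sup>+\<xi>. ennreal (c\<^sup>2) * ennreal ((norm (H \<xi>))\<^sup>2) \<partial>lborel)"
    by (simp add: ennreal_mult)
  also have "\<dots> = ennreal (c\<^sup>2) * (\<integral>\<^sup>+\<xi>. ennreal ((norm (H \<xi>))\<^sup>2) \<partial>lborel)"
    by (rule nn_integral_cmult) measurable
  also have "\<dots> \<le> ennreal (c\<^sup>2) * B" by (intro mult_left_mono HB) simp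
  also have "\<dots> = ennreal (c\<^sup>2 * (2 * pi) powr real DIM('a)) * (\<integral>\<^sup>+x. ennreal ((norm (f x))\<^sup>2) \<partial>lborel)"
    unfolding B_def by (subst ennreal_mult) (auto simp: mult.assoc)
  also have "c\<^sup>2 * (2 * pi) powr real DIM('a) = 1"
    unfolding c2 powr_add[symmetric] by simp
  finally show ?thesis by simp
qed

section \<open>Existence of the transform on L2\<close>

lemma AE_convergent_of_fast_L2_Cauchy:
  fixes u :: "nat \<Rightarrow> 'a \<Rightarrow> 'b::{banach, second_countable_topology}"
  assumes [measurable]: "\<And>k. u k \<in> borel_measurable M"
    and fast: "\<And>k. (\<integral>\<^sup>+x. ennreal ((norm (u (Suc k) x - u k x))\<^sup>2) \<partial>M) \<le> ennreal ((1 / 4) ^ k)"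
  shows "AE x in M. convergent (\<lambda>k. u k x)"
proof -
  define d where "d = (\<lambda>k x. u (Suc k) x - u k x)"
  \<comment> \<open>The weights 2^k are still summable against 4^(-k), so S is finite almost
    everywhere; finiteness at x forces the increments to decay like 2^(-k/2), a summable
    rate.\<close>
  define S where "S = (\<lambda>x. \<Sum>k. ennreal (2 ^ k) * ennreal ((norm (d k x))\<^sup>2))"
  have [measurable]: "d k \<in> borel_measurable M" for k unfolding d_def by measurable
  have [measurable]: "S \<in> borel_measurable M" unfolding S_def by measurable
  have "(\<integral>\<^sup>+x. S x \<partial>M) = (\<Sum>k. ennreal (2 ^ k) * (\<integral>\<^sup>+x. ennreal ((norm (d k x))\<^sup>2) \<partial>M))"
    unfolding S_def by (simp add: nn_integral_suminf nn_integral_cmult)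
  also have "\<dots> \<le> (\<Sum>k. ennreal (2 ^ k) * ennreal ((1 / 4) ^ k))"
    using fast unfolding d_def by (intro suminf_le mult_left_mono) auto
  also have "(\<lambda>k. ennreal (2 ^ k) * ennreal ((1 / 4) ^ k)) = (\<lambda>k. ennreal ((1 / 2) ^ k))"
    by (intro ext) (simp add: ennreal_mult[symmetric] power_mult_distrib[symmetric])
  also have "(\<Sum>k. ennreal ((1 / 2) ^ k)) = ennreal (\<Sum>k. (1 / 2) ^ k)"
    by (intro suminf_ennreal2) auto
  also have "\<dots> < \<infinity>" by simp
  finally have "AE x in M. S x \<noteq> \<infinity>" by (intro nn_integral_noteq_infinite) auto
  thus ?thesis
  proof (rule AE_mp, intro AE_I2 impI)
    fix x assume "S x \<noteq> \<infinity>"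
    then obtain C where C: "S x = ennreal C" "C \<ge> 0" by (cases "S x") auto
    have bound: "norm (d k x) \<le> sqrt C * (sqrt (1 / 2)) ^ k" for k
    proof -
      have "ennreal (2 ^ k) * ennreal ((norm (d k x))\<^sup>2) \<le> S x"
        unfolding S_def using sum_le_suminf[of "\<lambda>k. ennreal (2 ^ k) * ennreal ((norm (d k x))\<^sup>2)" "{k}"] by simp
      hence "2 ^ k * (norm (d k x))\<^sup>2 \<le> C" using C by (simp add: ennreal_mult[symmetric])
      hence "(norm (d k x))\<^sup>2 \<le> C * (1 / 2) ^ k" by (simp add: field_simps)
      hence "norm (d k x) \<le> sqrt (C * (1 / 2) ^ k)" by (rule real_le_rsqrt)
      thus ?thesis by (simp only: real_sqrt_mult real_sqrt_power)
    qed
    have "summable (\<lambda>k. d k x)"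
      by (rule summable_comparison_test'[of "\<lambda>k. sqrt C * (sqrt (1 / 2)) ^ k" 0])
        (use bound in \<open>auto intro!: summable_mult summable_geometric simp: real_sqrt_divide\<close>)
    hence "convergent (\<lambda>n. \<Sum>k<n. d k x)" by (simp add: summable_iff_convergent)
    hence "convergent (\<lambda>n. u n x - u 0 x)" unfolding d_def sum_lessThan_telescope[of "\<lambda>n. u n x"] .
    hence "convergent (\<lambda>n. (u n x - u 0 x) + u 0 x)" by (intro convergent_add convergent_const)
    thus "convergent (\<lambda>k. u k x)" by simp
  qed
qed

lemma nn_integral_norm_add_sq:
  fixes f g :: "'a \<Rightarrow> 'b::{real_normed_vector, second_countable_topology}"
  assumes [measurable]: "f \<in> borel_measurable M" "g \<in> borel_measurable M"
  shows "(\<integral>\<^sup>+x. ennreal ((norm (f x + g x))\<^sup>2) \<partial>M) \<le>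
    2 * (\<integral>\<^sup>+x. ennreal ((norm (f x))\<^sup>2) \<partial>M) + 2 * (\<integral>\<^sup>+x. ennreal ((norm (g x))\<^sup>2) \<partial>M)"
proof -
  have "(\<integral>\<^sup>+x. ennreal ((norm (f x + g x))\<^sup>2) \<partial>M) \<le>
    (\<integral>\<^sup>+x. 2 * ennreal ((norm (f x))\<^sup>2) + 2 * ennreal ((norm (g x))\<^sup>2) \<partial>M)"
  proof (intro nn_integral_mono)
    fix x
    have "(norm (f x + g x))\<^sup>2 \<le> (norm (f x) + norm (g x))\<^sup>2"
      by (intro power_mono norm_triangle_ineq) auto
    also have "\<dots> \<le> 2 * (norm (f x))\<^sup>2 + 2 * (norm (g x))\<^sup>2"
      using sum_squares_bound[of "norm (f x)" "norm (g x)"] by (simp add: power2_sum)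
    finally have "ennreal ((norm (f x + g x))\<^sup>2) \<le> ennreal (2 * (norm (f x))\<^sup>2 + 2 * (norm (g x))\<^sup>2)"
      by (rule ennreal_leI)
    thus "ennreal ((norm (f x + g x))\<^sup>2) \<le> 2 * ennreal ((norm (f x))\<^sup>2) + 2 * ennreal ((norm (g x))\<^sup>2)"
      by (simp add: ennreal_mult)
  qed
  also have "\<dots> = 2 * (\<integral>\<^sup>+x. ennreal ((norm (f x))\<^sup>2) \<partial>M) + 2 * (\<integral>\<^sup>+x. ennreal ((norm (g x))\<^sup>2) \<partial>M)"
    by (simp add: nn_integral_add nn_integral_cmult)
  finally show ?thesis .
qed

lemma L2_space_iff:
  "f \<in> L2_space \<longleftrightarrow> f \<in> borel_measurable borel \<and> (\<integral>\<^sup>+x. ennreal ((norm (f x))\<^sup>2) \<partial>lborel) < \<infinity>"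
  unfolding L2_space_def by (auto simp: integrable_iff_bounded)

lemma L2_norm_sq:
  assumes "f \<in> L2_space"
  shows "(\<integral>\<^sup>+x. ennreal ((norm (f x))\<^sup>2) \<partial>lborel) = ennreal ((L2_norm f)\<^sup>2)"
  using assms unfolding L2_space_def L2_norm_def
  by (subst nn_integral_eq_integral) (auto simp: integral_nonneg_AE)

lemma L2_space_diff:
  assumes f: "f \<in> L2_space" and g: "g \<in> L2_space"
  shows "(\<lambda>x. f x - g x) \<in> L2_space"
proof -
  have [measurable]: "f \<in> borel_measurable borel" "g \<in> borel_measurable borel"
    using f g by (auto simp: L2_space_iff)
  have "(\<integral>\<^sup>+x. ennreal ((norm (f x - g x))\<^sup>2) \<partial>lborel) \<le>
    2 * (\<integral>\<^sup>+x. ennreal ((norm (f x))\<^sup>2) \<partial>lborel) + 2 * (\<integral>\<^sup>+x. ennreal ((norm (g x))\<^sup>2) \<partial>lborel)"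
    using nn_integral_norm_add_sq[of f lborel "\<lambda>x. - g x"] by simp
  also have "\<dots> < \<infinity>" using f g by (simp add: L2_space_iff ennreal_mult_less_top)
  finally show ?thesis by (simp add: L2_space_iff)
qed

definition ball_truncation :: "('a::euclidean_space \<Rightarrow> complex) \<Rightarrow> real \<Rightarrow> 'a \<Rightarrow> complex" where
  "ball_truncation f R = (\<lambda>x. if norm x \<le> R then f x else 0)"

lemma ball_truncation_measurable [measurable]:
  assumes [measurable]: "f \<in> borel_measurable borel"
  shows "ball_truncation f R \<in> borel_measurable borel"
  unfolding ball_truncation_def by measurable

text \<open>On the ball |f| \<le> 1 + |f|^2, and both summands have finite integral there.\<close>

lemma integrable_ball_truncation:
  fixes f :: "'a::euclidean_space \<Rightarrow> complex"
  assumes "f \<in> L2_space"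
  shows "integrable lborel (ball_truncation f R)"
proof -
  have [measurable]: "f \<in> borel_measurable borel" using assms by (simp add: L2_space_iff)
  show ?thesis
  proof (rule Bochner_Integration.integrable_bound)
    show "integrable lborel (\<lambda>x. indicator (cball 0 R) x + (norm (f x))\<^sup>2 :: real)"
    proof (rule Bochner_Integration.integrable_add)
      show "integrable lborel (indicat_real (cball (0::'a) R))"
        using emeasure_bounded_finite[OF bounded_cball, of "0::'a" R] by (subst integrable_indicator_iff) auto
      show "integrable lborel (\<lambda>x. (norm (f x))\<^sup>2)" using assms by (simp add: L2_space_def)
    qed
    show "AE x in lborel. norm (ball_truncation f R x) \<le> norm (indicator (cball 0 R) x + (norm (f x))\<^sup>2 :: real)"
    proof (intro AE_I2)
      fix x
      have "norm (f x) \<le> 1 + (norm (f x))\<^sup>2"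
        using sum_squares_bound[of "norm (f x)" 1] by (simp) (smt (verit) norm_ge_zero)
      thus "norm (ball_truncation f R x) \<le> norm (indicator (cball 0 R) x + (norm (f x))\<^sup>2 :: real)"
        by (auto simp: ball_truncation_def indicator_def)
    qed
  qed measurable
qed

lemma fourier_integral_diff:
  assumes "integrable lborel f" "integrable lborel g"
  shows "fourier_integral (\<lambda>x. f x - g x) \<xi> = fourier_integral f \<xi> - fourier_integral g \<xi>"
  using integrable_exp_kernel[OF assms(1), of \<xi>] integrable_exp_kernel[OF assms(2), of \<xi>]
  unfolding fourier_integral_def left_diff_distrib
  by (subst Bochner_Integration.integral_diff) (auto simp: algebra_simps)

text \<open>Two truncations at radii beyond R agree inside the ball of radius R. By Bessel their
  transforms are therefore Cauchy in L2, at a rate given by the tail of f.\<close>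

lemma bessel_ball_truncation_diff:
  fixes f :: "'a::euclidean_space \<Rightarrow> complex"
  assumes f: "f \<in> L2_space" and R: "R \<le> R1" "R \<le> R2"
  shows "(\<integral>\<^sup>+\<xi>. ennreal ((norm (fourier_integral (ball_truncation f R1) \<xi> - fourier_integral (ball_truncation f R2) \<xi>))\<^sup>2) \<partial>lborel)
    \<le> (\<integral>\<^sup>+x. ennreal (indicator {x. R < norm x} x * (norm (f x))\<^sup>2) \<partial>lborel)"
proof -
  note i = integrable_ball_truncation[OF f]
  have "(\<integral>\<^sup>+\<xi>. ennreal ((norm (fourier_integral (ball_truncation f R1) \<xi> - fourier_integral (ball_truncation f R2) \<xi>))\<^sup>2) \<partial>lborel)
    \<le> (\<integral>\<^sup>+x. ennreal ((norm (ball_truncation f R1 x - ball_truncation f R2 x))\<^sup>2) \<partial>lborel)"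
    unfolding fourier_integral_diff[OF i i, symmetric] by (intro bessel_fourier_integral Bochner_Integration.integrable_diff i)
  also have "\<dots> \<le> (\<integral>\<^sup>+x. ennreal (indicator {x. R < norm x} x * (norm (f x))\<^sup>2) \<partial>lborel)"
    using R by (intro nn_integral_mono ennreal_leI) (auto simp: ball_truncation_def indicator_def)
  finally show ?thesis .
qed

lemma L2_tail_tendsto_0:
  fixes f :: "'a::euclidean_space \<Rightarrow> complex"
  assumes "f \<in> L2_space"
  shows "((\<lambda>R. \<integral>\<^sup>+x. ennreal (indicator {x. R < norm x} x * (norm (f x))\<^sup>2) \<partial>lborel) \<longlongrightarrow> 0) at_top"
proof -
  have [measurable]: "f \<in> borel_measurable borel" using assms by (simp add: L2_space_iff)
  have int: "integrable lborel (\<lambda>x. (norm (f x))\<^sup>2)" using assms by (simp add: L2_space_def)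
  have intR: "integrable lborel (\<lambda>x. indicator {x. R < norm x} x * (norm (f x))\<^sup>2)" for R :: real
    by (rule Bochner_Integration.integrable_bound[OF int]) (auto simp: indicator_def)
  have "((\<lambda>R. LINT x|lborel. indicator {x. R < norm x} x * (norm (f x))\<^sup>2) \<longlongrightarrow> integral\<^sup>L (lborel :: 'a measure) (\<lambda>x. 0 :: real)) at_top"
  proof (rule integral_dominated_convergence_at_top[OF _ _ int])
    show "AE x in lborel. ((\<lambda>R. indicator {x. R < norm x} x * (norm (f x))\<^sup>2) \<longlongrightarrow> 0) at_top"
    proof (intro AE_I2 tendsto_eventually)
      fix x :: 'a
      show "eventually (\<lambda>R. indicator {x. R < norm x} x * (norm (f x))\<^sup>2 = 0) at_top"
        using eventually_ge_at_top[of "norm x"] by eventually_elim (auto simp: indicator_def)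
    qed
    show "\<forall>\<^sub>F R in at_top. AE x in lborel. norm (indicator {x. R < norm x} x * (norm (f x))\<^sup>2) \<le> (norm (f x))\<^sup>2"
      by (intro always_eventually allI AE_I2) (auto simp: indicator_def)
  qed measurable
  hence "((\<lambda>R. ennreal (LINT x|lborel. indicator {x. R < norm x} x * (norm (f x))\<^sup>2)) \<longlongrightarrow> ennreal 0) at_top"
    by (intro tendsto_ennrealI) simp
  moreover have "ennreal (LINT x|lborel. indicator {x. R < norm x} x * (norm (f x))\<^sup>2) =
    (\<integral>\<^sup>+x. ennreal (indicator {x. R < norm x} x * (norm (f x))\<^sup>2) \<partial>lborel)" for R :: real
    by (rule nn_integral_eq_integral[OF intR, symmetric]) auto
  ultimately show ?thesis by simp
qed

text \<open>This is the completeness argument for L2, carried out with functions: a fast subsequence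
  converges almost everywhere, and Fatou shows that its limit stays within the tail of every
  truncated transform.\<close>

lemma is_fourier_L2_exists:
  fixes f :: "'a::euclidean_space \<Rightarrow> complex"
  assumes f: "f \<in> L2_space"
  shows "\<exists>F. is_fourier_L2 f F"
proof -
  have [measurable]: "f \<in> borel_measurable borel" using f by (simp add: L2_space_iff)
  define S where "S = (\<lambda>R. fourier_integral (ball_truncation f R))"
  have S_meas [measurable]: "S R \<in> borel_measurable borel" for R unfolding S_def by measurable
  define tail where "tail = (\<lambda>R. \<integral>\<^sup>+x. ennreal (indicator {x. R < norm x} x * (norm (f x))\<^sup>2) \<partial>lborel)"
  have tail0: "(tail \<longlongrightarrow> 0) at_top" unfolding tail_def by (rule L2_tail_tendsto_0[OF f])
  have S_tail: "(\<integral>\<^sup>+\<xi>. ennreal ((norm (S R1 \<xi> - S R2 \<xi>))\<^sup>2) \<partial>lborel) \<le> tail R" if "R \<le> R1" "R \<le> R2" for R R1 R2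
    unfolding S_def tail_def by (rule bessel_ball_truncation_diff[OF f that])
  have "\<exists>R. R \<ge> real k \<and> tail R \<le> ennreal ((1 / 4) ^ k)" for k
  proof -
    have "eventually (\<lambda>R. tail R < ennreal ((1 / 4) ^ k)) at_top"
      by (rule order_tendstoD(2)[OF tail0]) simp
    hence "eventually (\<lambda>R. R \<ge> real k \<and> tail R \<le> ennreal ((1 / 4) ^ k)) at_top"
      using eventually_ge_at_top[of "real k"] by eventually_elim auto
    thus ?thesis by (auto simp: eventually_at_top_linorder)
  qed
  \<comment> \<open>The tail bound gives the fast Cauchy rate; \<open>r k \<ge> real k\<close> lets
    the radii eventually pass any R. They need not increase, hence the case distinction that
    follows.\<close>
  then obtain r where r: "\<And>k. r k \<ge> real k" "\<And>k. tail (r k) \<le> ennreal ((1 / 4) ^ k)" by metis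
  have fast: "(\<integral>\<^sup>+\<xi>. ennreal ((norm (S (r (Suc k)) \<xi> - S (r k) \<xi>))\<^sup>2) \<partial>lborel) \<le> ennreal ((1 / 4) ^ k)" for k
  proof (cases "r k \<le> r (Suc k)")
    case True
    thus ?thesis using S_tail[of "r k" "r (Suc k)" "r k"] r(2)[of k] by auto
  next
    case False
    have "(\<integral>\<^sup>+\<xi>. ennreal ((norm (S (r (Suc k)) \<xi> - S (r k) \<xi>))\<^sup>2) \<partial>lborel) \<le> ennreal ((1 / 4) ^ Suc k)"
      using False S_tail[of "r (Suc k)" "r (Suc k)" "r k"] r(2)[of "Suc k"] by auto
    also have "\<dots> \<le> ennreal ((1 / 4) ^ k)" by (intro ennreal_leI) simp
    finally show ?thesis .
  qed
  define F where "F = (\<lambda>\<xi>. lim (\<lambda>k. S (r k) \<xi>))"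
  have F_meas [measurable]: "F \<in> borel_measurable borel"
    unfolding F_def by (rule borel_measurable_lim_metric) measurable
  have "AE \<xi> in lborel. convergent (\<lambda>k. S (r k) \<xi>)"
    by (rule AE_convergent_of_fast_L2_Cauchy[OF _ fast]) measurable
  hence conv: "AE \<xi> in lborel. (\<lambda>k. S (r k) \<xi>) \<longlonglongrightarrow> F \<xi>"
    by eventually_elim (simp add: F_def convergent_LIMSEQ_iff)
  have F_tail: "(\<integral>\<^sup>+\<xi>. ennreal ((norm (F \<xi> - S R \<xi>))\<^sup>2) \<partial>lborel) \<le> tail R" for R
  proof -
    have "(\<integral>\<^sup>+\<xi>. ennreal ((norm (F \<xi> - S R \<xi>))\<^sup>2) \<partial>lborel) =
      (\<integral>\<^sup>+\<xi>. liminf (\<lambda>k. ennreal ((norm (S (r k) \<xi> - S R \<xi>))\<^sup>2)) \<partial>lborel)"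
    proof (rule nn_integral_cong_AE, use conv in eventually_elim)
      fix \<xi> assume "(\<lambda>k. S (r k) \<xi>) \<longlonglongrightarrow> F \<xi>"
      hence "(\<lambda>k. ennreal ((norm (S (r k) \<xi> - S R \<xi>))\<^sup>2)) \<longlonglongrightarrow> ennreal ((norm (F \<xi> - S R \<xi>))\<^sup>2)"
        by (intro tendsto_ennrealI tendsto_intros)
      thus "ennreal ((norm (F \<xi> - S R \<xi>))\<^sup>2) = liminf (\<lambda>k. ennreal ((norm (S (r k) \<xi> - S R \<xi>))\<^sup>2))"
        by (intro lim_imp_Liminf[symmetric]) auto
    qed
    also have "\<dots> \<le> liminf (\<lambda>k. \<integral>\<^sup>+\<xi>. ennreal ((norm (S (r k) \<xi> - S R \<xi>))\<^sup>2) \<partial>lborel)"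
      by (intro nn_integral_liminf) measurable
    also have "\<dots> \<le> liminf (\<lambda>_::nat. tail R)"
    proof (rule Liminf_mono)
      show "eventually (\<lambda>k. (\<integral>\<^sup>+\<xi>. ennreal ((norm (S (r k) \<xi> - S R \<xi>))\<^sup>2) \<partial>lborel) \<le> tail R) sequentially"
        using eventually_ge_at_top[of "nat \<lceil>R\<rceil>"]
      proof eventually_elim
        case (elim k)
        hence "R \<le> r k" using r(1)[of k] by linarith
        thus ?case by (intro S_tail) auto
      qed
    qed
    also have "\<dots> = tail R" by (simp add: Liminf_const)
    finally show ?thesis .
  qed
  have "tail 0 \<le> (\<integral>\<^sup>+x. ennreal ((norm (f x))\<^sup>2) \<partial>lborel)"
    unfolding tail_def by (intro nn_integral_mono ennreal_leI) (auto simp: indicator_def)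
  moreover have fin: "(\<integral>\<^sup>+x. ennreal ((norm (f x))\<^sup>2) \<partial>lborel) < \<infinity>" using f by (simp add: L2_space_iff)
  ultimately have tail_fin: "tail 0 < \<infinity>" by (rule le_less_trans)
  have "(\<integral>\<^sup>+\<xi>. ennreal ((norm (S 0 \<xi>))\<^sup>2) \<partial>lborel) \<le> (\<integral>\<^sup>+x. ennreal ((norm (ball_truncation f 0 x))\<^sup>2) \<partial>lborel)"
    unfolding S_def by (intro bessel_fourier_integral integrable_ball_truncation f)
  also have "\<dots> \<le> (\<integral>\<^sup>+x. ennreal ((norm (f x))\<^sup>2) \<partial>lborel)"
    by (intro nn_integral_mono ennreal_leI) (auto simp: ball_truncation_def)
  finally have S_fin: "(\<integral>\<^sup>+\<xi>. ennreal ((norm (S 0 \<xi>))\<^sup>2) \<partial>lborel) < \<infinity>" using fin by (rule le_less_trans)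
  have "(\<integral>\<^sup>+\<xi>. ennreal ((norm (F \<xi>))\<^sup>2) \<partial>lborel) \<le> 2 * (\<integral>\<^sup>+\<xi>. ennreal ((norm (F \<xi> - S 0 \<xi>))\<^sup>2) \<partial>lborel)
     + 2 * (\<integral>\<^sup>+\<xi>. ennreal ((norm (S 0 \<xi>))\<^sup>2) \<partial>lborel)"
    using nn_integral_norm_add_sq[of "\<lambda>\<xi>. F \<xi> - S 0 \<xi>" lborel "S 0"] by simp
  also have "\<dots> < \<infinity>"
    using S_fin le_less_trans[OF F_tail[of 0] tail_fin] by (simp add: ennreal_mult_less_top)
  finally have "F \<in> L2_space" by (simp add: L2_space_iff)
  moreover have "((\<lambda>R. \<integral>\<^sup>+\<xi>. ennreal ((norm (F \<xi> - S R \<xi>))\<^sup>2) \<partial>lborel) \<longlongrightarrow> 0) at_top"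
    by (rule tendsto_sandwich[OF _ _ tendsto_const tail0]) (auto simp: F_tail)
  ultimately show ?thesis unfolding is_fourier_L2_def S_def ball_truncation_def by blast
qed

section \<open>Linearity and boundedness on L2\<close>

lemma is_fourier_L2_fourier: "f \<in> L2_space \<Longrightarrow> is_fourier_L2 f (fourier f)"
  unfolding fourier_def by (rule someI_ex[OF is_fourier_L2_exists])

lemma fourier_L2_space: "f \<in> L2_space \<Longrightarrow> fourier f \<in> L2_space"
  using is_fourier_L2_fourier by (auto simp: is_fourier_L2_def)

lemma is_fourier_L2_iff:
  "is_fourier_L2 f F \<longleftrightarrow> F \<in> L2_space \<and>
    ((\<lambda>R. \<integral>\<^sup>+\<xi>. ennreal ((norm (F \<xi> - fourier_integral (ball_truncation f R) \<xi>))\<^sup>2) \<partial>lborel) \<longlongrightarrow> 0) at_top"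
  unfolding is_fourier_L2_def ball_truncation_def ..

lemma is_fourier_L2_diff:
  fixes f g :: "'a::euclidean_space \<Rightarrow> complex"
  assumes f: "f \<in> L2_space" and g: "g \<in> L2_space" and F: "is_fourier_L2 f F" and G: "is_fourier_L2 g G"
  shows "is_fourier_L2 (\<lambda>x. f x - g x) (\<lambda>\<xi>. F \<xi> - G \<xi>)"
  unfolding is_fourier_L2_iff
proof
  have FG: "F \<in> L2_space" "G \<in> L2_space" using F G by (auto simp: is_fourier_L2_def)
  have [measurable]: "f \<in> borel_measurable borel" "g \<in> borel_measurable borel"
    "F \<in> borel_measurable borel" "G \<in> borel_measurable borel"
    using f g FG by (auto simp: L2_space_iff)
  show "(\<lambda>\<xi>. F \<xi> - G \<xi>) \<in> L2_space" by (rule L2_space_diff[OF FG])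
  define a where "a = (\<lambda>R. \<integral>\<^sup>+\<xi>. ennreal ((norm (F \<xi> - fourier_integral (ball_truncation f R) \<xi>))\<^sup>2) \<partial>lborel)"
  define b where "b = (\<lambda>R. \<integral>\<^sup>+\<xi>. ennreal ((norm (G \<xi> - fourier_integral (ball_truncation g R) \<xi>))\<^sup>2) \<partial>lborel)"
  have "(a \<longlongrightarrow> 0) at_top" "(b \<longlongrightarrow> 0) at_top" using F G unfolding is_fourier_L2_iff a_def b_def by auto
  hence "((\<lambda>R. 2 * a R + 2 * b R) \<longlongrightarrow> 2 * 0 + 2 * 0) at_top"
    by (intro tendsto_add ennreal_tendsto_cmult) auto
  hence ab: "((\<lambda>R. 2 * a R + 2 * b R) \<longlongrightarrow> 0) at_top" by simp
  have le: "(\<integral>\<^sup>+\<xi>. ennreal ((norm (F \<xi> - G \<xi> - fourier_integral (ball_truncation (\<lambda>x. f x - g x) R) \<xi>))\<^sup>2) \<partial>lborel) \<le> 2 * a R + 2 * b R" for R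
  proof -
    have "ball_truncation (\<lambda>x. f x - g x) R = (\<lambda>x. ball_truncation f R x - ball_truncation g R x)"
      by (auto simp: ball_truncation_def)
    hence e: "F \<xi> - G \<xi> - fourier_integral (ball_truncation (\<lambda>x. f x - g x) R) \<xi> =
       (F \<xi> - fourier_integral (ball_truncation f R) \<xi>) + - (G \<xi> - fourier_integral (ball_truncation g R) \<xi>)" for \<xi>
      using fourier_integral_diff[OF integrable_ball_truncation[OF f] integrable_ball_truncation[OF g], of R R \<xi>]
      by (simp add: algebra_simps)
    show ?thesis unfolding e a_def b_def
      by (rule order_trans[OF nn_integral_norm_add_sq]) (auto simp: norm_minus_commute)
  qed
  show "((\<lambda>R. \<integral>\<^sup>+\<xi>. ennreal ((norm (F \<xi> - G \<xi> - fourier_integral (ball_truncation (\<lambda>x. f x - g x) R) \<xi>))\<^sup>2) \<partial>lborel) \<longlongrightarrow> 0) at_top"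
    by (rule tendsto_sandwich[OF _ _ tendsto_const ab]) (auto simp: le)
qed

text \<open>The inequality \<open>|a + b|\<^sup>2 \<le> 2 |a|\<^sup>2 + 2 |b|\<^sup>2\<close> replaces Minkowski; hence the factor 2.\<close>

lemma is_fourier_L2_bound:
  fixes f :: "'a::euclidean_space \<Rightarrow> complex"
  assumes f: "f \<in> L2_space" and F: "is_fourier_L2 f F"
  shows "(\<integral>\<^sup>+\<xi>. ennreal ((norm (F \<xi>))\<^sup>2) \<partial>lborel) \<le> 2 * (\<integral>\<^sup>+x. ennreal ((norm (f x))\<^sup>2) \<partial>lborel)"
proof (rule tendsto_lowerbound)
  have [measurable]: "f \<in> borel_measurable borel" "F \<in> borel_measurable borel"
    using f F by (auto simp: L2_space_iff is_fourier_L2_def)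
  define a where "a = (\<lambda>R. \<integral>\<^sup>+\<xi>. ennreal ((norm (F \<xi> - fourier_integral (ball_truncation f R) \<xi>))\<^sup>2) \<partial>lborel)"
  have "(a \<longlongrightarrow> 0) at_top" using F unfolding is_fourier_L2_iff a_def by auto
  hence "((\<lambda>R. 2 * a R + 2 * (\<integral>\<^sup>+x. ennreal ((norm (f x))\<^sup>2) \<partial>lborel)) \<longlongrightarrow>
     2 * 0 + 2 * (\<integral>\<^sup>+x. ennreal ((norm (f x))\<^sup>2) \<partial>lborel)) at_top"
    by (intro tendsto_add ennreal_tendsto_cmult tendsto_const) auto
  thus "((\<lambda>R. 2 * a R + 2 * (\<integral>\<^sup>+x. ennreal ((norm (f x))\<^sup>2) \<partial>lborel)) \<longlongrightarrow>
     2 * (\<integral>\<^sup>+x. ennreal ((norm (f x))\<^sup>2) \<partial>lborel)) at_top" by simp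
  have "(\<integral>\<^sup>+\<xi>. ennreal ((norm (F \<xi>))\<^sup>2) \<partial>lborel) \<le> 2 * a R + 2 * (\<integral>\<^sup>+x. ennreal ((norm (f x))\<^sup>2) \<partial>lborel)" for R
  proof -
    have "(\<integral>\<^sup>+\<xi>. ennreal ((norm (F \<xi>))\<^sup>2) \<partial>lborel) \<le> 2 * a R +
      2 * (\<integral>\<^sup>+\<xi>. ennreal ((norm (fourier_integral (ball_truncation f R) \<xi>))\<^sup>2) \<partial>lborel)"
      using nn_integral_norm_add_sq[of "\<lambda>\<xi>. F \<xi> - fourier_integral (ball_truncation f R) \<xi>" lborel
          "fourier_integral (ball_truncation f R)"] unfolding a_def by simp
    also have "\<dots> \<le> 2 * a R + 2 * (\<integral>\<^sup>+x. ennreal ((norm (ball_truncation f R x))\<^sup>2) \<partial>lborel)"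
      by (intro add_left_mono mult_left_mono bessel_fourier_integral integrable_ball_truncation f) auto
    also have "\<dots> \<le> 2 * a R + 2 * (\<integral>\<^sup>+x. ennreal ((norm (f x))\<^sup>2) \<partial>lborel)"
      by (intro add_left_mono mult_left_mono nn_integral_mono ennreal_leI) (auto simp: ball_truncation_def)
    finally show ?thesis .
  qed
  thus "eventually (\<lambda>R. (\<integral>\<^sup>+\<xi>. ennreal ((norm (F \<xi>))\<^sup>2) \<partial>lborel) \<le>
     2 * a R + 2 * (\<integral>\<^sup>+x. ennreal ((norm (f x))\<^sup>2) \<partial>lborel)) at_top" by simp
qed simp

text \<open>Both sides are transforms of the same function f - g. Their difference is thus a
  transform of the zero function, and the L2 bound makes it vanish almost everywhere.\<close>

lemma fourier_diff_AE:
  fixes f g :: "'a::euclidean_space \<Rightarrow> complex"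
  assumes f: "f \<in> L2_space" and g: "g \<in> L2_space"
  shows "AE \<xi> in lborel. fourier (\<lambda>x. f x - g x) \<xi> = fourier f \<xi> - fourier g \<xi>"
proof -
  let ?h = "\<lambda>x. f x - g x"
  define D where "D = (\<lambda>\<xi>. fourier ?h \<xi> - (fourier f \<xi> - fourier g \<xi>))"
  have h: "?h \<in> L2_space" by (rule L2_space_diff[OF f g])
  have D_is: "is_fourier_L2 (\<lambda>x. ?h x - ?h x) D"
    unfolding D_def by (intro is_fourier_L2_diff[OF h h] is_fourier_L2_diff[OF f g] is_fourier_L2_fourier f g h)
  have [measurable]: "D \<in> borel_measurable borel"
    using D_is by (auto simp: is_fourier_L2_def L2_space_iff)
  have "(\<integral>\<^sup>+\<xi>. ennreal ((norm (D \<xi>))\<^sup>2) \<partial>lborel) \<le> 2 * (\<integral>\<^sup>+x. ennreal ((norm (?h x - ?h x))\<^sup>2) \<partial>lborel)"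
    by (rule is_fourier_L2_bound[OF L2_space_diff[OF h h] D_is])
  hence "(\<integral>\<^sup>+\<xi>. ennreal ((norm (D \<xi>))\<^sup>2) \<partial>lborel) = 0" by simp
  hence "AE \<xi> in lborel. ennreal ((norm (D \<xi>))\<^sup>2) = 0" by (subst (asm) nn_integral_0_iff_AE) auto
  thus ?thesis by eventually_elim (simp add: D_def)
qed

lemma fourier_diff_bound:
  fixes f g :: "'a::euclidean_space \<Rightarrow> complex"
  assumes f: "f \<in> L2_space" and g: "g \<in> L2_space"
  shows "(\<integral>\<^sup>+\<xi>. ennreal ((norm (fourier f \<xi> - fourier g \<xi>))\<^sup>2) \<partial>lborel) \<le>
    2 * (\<integral>\<^sup>+x. ennreal ((norm (f x - g x))\<^sup>2) \<partial>lborel)"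
  by (intro is_fourier_L2_bound L2_space_diff f g is_fourier_L2_diff is_fourier_L2_fourier)

lemma fourier_cong_AE:
  fixes f g :: "'a::euclidean_space \<Rightarrow> complex"
  assumes f: "f \<in> L2_space" and g: "g \<in> L2_space" and "AE x in lborel. f x = g x"
  shows "AE \<xi> in lborel. fourier f \<xi> = fourier g \<xi>"
proof -
  have [measurable]: "fourier f \<in> borel_measurable borel" "fourier g \<in> borel_measurable borel"
    using fourier_L2_space[OF f] fourier_L2_space[OF g] by (auto simp: L2_space_iff)
  have "(\<integral>\<^sup>+x. ennreal ((norm (f x - g x))\<^sup>2) \<partial>lborel) = (\<integral>\<^sup>+x. 0 \<partial>(lborel :: 'a measure))"
    using assms(3) by (intro nn_integral_cong_AE) (auto elim: eventually_mono)
  hence "(\<integral>\<^sup>+\<xi>. ennreal ((norm (fourier f \<xi> - fourier g \<xi>))\<^sup>2) \<partial>lborel) = 0"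
    using fourier_diff_bound[OF f g] by simp
  hence "AE \<xi> in lborel. ennreal ((norm (fourier f \<xi> - fourier g \<xi>))\<^sup>2) = 0"
    by (subst (asm) nn_integral_0_iff_AE) auto
  thus ?thesis by eventually_elim simp
qed

lemma L2_norm_fourier_diff:
  fixes f g :: "'a::euclidean_space \<Rightarrow> complex"
  assumes f: "f \<in> L2_space" and g: "g \<in> L2_space"
  shows "L2_norm (\<lambda>\<xi>. fourier f \<xi> - fourier g \<xi>) \<le> sqrt 2 * L2_norm (\<lambda>x. f x - g x)"
proof -
  have "ennreal ((L2_norm (\<lambda>\<xi>. fourier f \<xi> - fourier g \<xi>))\<^sup>2) \<le> 2 * ennreal ((L2_norm (\<lambda>x. f x - g x))\<^sup>2)"
    using fourier_diff_bound[OF f g]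
    by (simp only: L2_norm_sq[OF L2_space_diff[OF f g]]
        L2_norm_sq[OF L2_space_diff[OF fourier_L2_space[OF f] fourier_L2_space[OF g]]])
  also have "\<dots> = ennreal (2 * (L2_norm (\<lambda>x. f x - g x))\<^sup>2)" by (simp add: ennreal_mult)
  finally have "(L2_norm (\<lambda>\<xi>. fourier f \<xi> - fourier g \<xi>))\<^sup>2 \<le> 2 * (L2_norm (\<lambda>x. f x - g x))\<^sup>2"
    by (subst (asm) ennreal_le_iff) auto
  also have "\<dots> = (sqrt 2 * L2_norm (\<lambda>x. f x - g x))\<^sup>2" by (simp add: power_mult_distrib)
  finally show ?thesis by (rule power2_le_imp_le) (simp add: L2_norm_def)
qed

text \<open>The passage from a pointwise estimate to norms. Membership in \<open>L2_space\<close> is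
  part of the conclusion because \<open>L2_norm\<close> says nothing outside it; sqrt 2 again stems
  from (a + b)^2 \<le> 2 a^2 + 2 b^2.\<close>

lemma L2_norm_le_of_AE_bound:
  fixes F P Q :: "'a::euclidean_space \<Rightarrow> complex"
  assumes F [measurable]: "F \<in> borel_measurable borel" and P: "P \<in> L2_space" and Q: "Q \<in> L2_space"
    and "a \<ge> 0" "b \<ge> 0"
    and le: "AE x in lborel. norm (F x) \<le> a * norm (P x) + b * norm (Q x)"
  shows "F \<in> L2_space" "L2_norm F \<le> sqrt 2 * (a * L2_norm P + b * L2_norm Q)"
proof -
  have [measurable]: "P \<in> borel_measurable borel" "Q \<in> borel_measurable borel"
    using P Q by (auto simp: L2_space_iff)
  have nn: "L2_norm P \<ge> 0" "L2_norm Q \<ge> 0" by (simp_all add: L2_norm_def)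
  have scale: "(\<integral>\<^sup>+x. ennreal ((norm (c * norm (R x)))\<^sup>2) \<partial>lborel) = ennreal (c\<^sup>2 * (L2_norm R)\<^sup>2)"
    if "R \<in> L2_space" for c :: real and R :: "'a \<Rightarrow> complex"
  proof -
    have [measurable]: "R \<in> borel_measurable borel" using that by (simp add: L2_space_iff)
    have "(\<integral>\<^sup>+x. ennreal ((norm (c * norm (R x)))\<^sup>2) \<partial>lborel) = (\<integral>\<^sup>+x. ennreal (c\<^sup>2) * ennreal ((norm (R x))\<^sup>2) \<partial>lborel)"
      by (simp add: ennreal_mult[symmetric] power_mult_distrib)
    also have "\<dots> = ennreal (c\<^sup>2) * ennreal ((L2_norm R)\<^sup>2)"
      by (simp add: nn_integral_cmult L2_norm_sq[OF that])
    finally show ?thesis by (simp add: ennreal_mult)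
  qed
  have "(\<integral>\<^sup>+x. ennreal ((norm (F x))\<^sup>2) \<partial>lborel) \<le>
     (\<integral>\<^sup>+x. ennreal ((norm (a * norm (P x) + b * norm (Q x)))\<^sup>2) \<partial>lborel)"
    using le by (intro nn_integral_mono_AE, eventually_elim) (auto intro!: ennreal_leI power_mono)
  also have "\<dots> \<le> 2 * ennreal (a\<^sup>2 * (L2_norm P)\<^sup>2) + 2 * ennreal (b\<^sup>2 * (L2_norm Q)\<^sup>2)"
    unfolding scale[OF P, symmetric] scale[OF Q, symmetric] by (rule nn_integral_norm_add_sq) measurable
  also have "\<dots> = ennreal (2 * (a * L2_norm P)\<^sup>2 + 2 * (b * L2_norm Q)\<^sup>2)"
    by (simp add: ennreal_mult power_mult_distrib)
  finally have I: "(\<integral>\<^sup>+x. ennreal ((norm (F x))\<^sup>2) \<partial>lborel) \<le> ennreal (2 * (a * L2_norm P)\<^sup>2 + 2 * (b * L2_norm Q)\<^sup>2)" .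
  have "\<dots> < \<infinity>" by simp
  with I have "(\<integral>\<^sup>+x. ennreal ((norm (F x))\<^sup>2) \<partial>lborel) < \<infinity>" by (rule le_less_trans)
  thus FL: "F \<in> L2_space" by (simp add: L2_space_iff)
  have "(L2_norm F)\<^sup>2 \<le> 2 * (a * L2_norm P)\<^sup>2 + 2 * (b * L2_norm Q)\<^sup>2"
    using I unfolding L2_norm_sq[OF FL] by (subst (asm) ennreal_le_iff) auto
  also have "\<dots> \<le> 2 * (a * L2_norm P + b * L2_norm Q)\<^sup>2"
    using assms(4,5) nn by (simp add: power2_sum)
  also have "\<dots> = (sqrt 2 * (a * L2_norm P + b * L2_norm Q))\<^sup>2" by (simp add: power_mult_distrib)
  finally show "L2_norm F \<le> sqrt 2 * (a * L2_norm P + b * L2_norm Q)"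
    by (rule power2_le_imp_le) (use assms(4,5) nn in simp)
qed

section \<open>Error estimates\<close>

lemma one_minus_exp_powr_le:
  fixes y q s \<tau> :: real
  assumes "y \<ge> 0" "0 \<le> q" "q \<le> s" "\<tau> > 0"
  shows "1 - exp (- \<tau> * y powr s) \<le> max 1 \<tau> * y powr q"
proof (cases "y \<le> 1")
  case True
  have "1 - exp (- \<tau> * y powr s) \<le> \<tau> * y powr s"
    using exp_ge_add_one_self[of "- \<tau> * y powr s"] by simp
  \<comment> \<open>Here q \<le> s enters: for y \<le> 1 powers decrease in the exponent. It is the
    origin of the condition p - l \<le> s.\<close>
  also have "\<dots> \<le> max 1 \<tau> * y powr q"
    using assms True by (intro mult_mono powr_mono') auto
  finally show ?thesis .
next
  case False
  have "1 - exp (- \<tau> * y powr s) \<le> 1 * 1" by simp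
  also have "\<dots> \<le> max 1 \<tau> * y powr q"
    using assms False by (intro mult_mono ge_one_powr_ge_zero) auto
  finally show ?thesis .
qed

lemma power2_powr_half:
  fixes x a :: real
  assumes "x > 0"
  shows "(x\<^sup>2) powr (a / 2) = x powr a"
proof -
  have "x\<^sup>2 = x powr 2" using assms by simp
  hence "(x\<^sup>2) powr (a / 2) = x powr (2 * (a / 2))" by (simp only: powr_powr)
  thus ?thesis by simp
qed

text \<open>The surplus of p - l derivatives pays for the smoothing: the factor r^(p-l) is absorbed
  by the stronger Sobolev weight and leaves \<alpha>^(p-l).\<close>

lemma smoothing_estimate:
  fixes l p s \<tau> \<alpha> r :: real
  assumes "0 \<le> l" "l \<le> p" "p - l \<le> s" "\<tau> > 0" "\<alpha> > 0" "r \<ge> 0"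
  shows "(1 + r\<^sup>2) powr (l / 2) * (1 - exp (- \<tau> * (\<alpha> * r) powr s))
     \<le> max 1 \<tau> * \<alpha> powr (p - l) * (1 + r\<^sup>2) powr (p / 2)"
proof -
  have "r powr (p - l) \<le> (1 + r\<^sup>2) powr ((p - l) / 2)"
  proof (cases "r = 0")
    case False
    hence "r powr (p - l) = (r\<^sup>2) powr ((p - l) / 2)"
      using assms by (simp add: power2_powr_half)
    also have "\<dots> \<le> (1 + r\<^sup>2) powr ((p - l) / 2)" using assms by (intro powr_mono2) auto
    finally show ?thesis .
  qed simp
  hence "(1 - exp (- \<tau> * (\<alpha> * r) powr s)) \<le> max 1 \<tau> * (\<alpha> powr (p - l) * (1 + r\<^sup>2) powr ((p - l) / 2))"
    using one_minus_exp_powr_le[of "\<alpha> * r" "p - l" s \<tau>] assms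
    by (simp add: powr_mult) (smt (verit) mult_left_mono max.cobounded1 powr_ge_zero)
  hence "(1 + r\<^sup>2) powr (l / 2) * (1 - exp (- \<tau> * (\<alpha> * r) powr s)) \<le>
    (1 + r\<^sup>2) powr (l / 2) * (max 1 \<tau> * (\<alpha> powr (p - l) * (1 + r\<^sup>2) powr ((p - l) / 2)))"
    by (intro mult_left_mono) auto
  also have "\<dots> = max 1 \<tau> * \<alpha> powr (p - l) * ((1 + r\<^sup>2) powr (l / 2) * (1 + r\<^sup>2) powr ((p - l) / 2))"
    by (simp only: mult_ac)
  also have "(1 + r\<^sup>2) powr (l / 2) * (1 + r\<^sup>2) powr ((p - l) / 2) = (1 + r\<^sup>2) powr (p / 2)"
    unfolding powr_add[symmetric] by (simp add: diff_divide_distrib)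
  finally show ?thesis .
qed

text \<open>For y > 1 the power is at most a constant times z^n, with z = \<tau> y^s and n \<ge>
  m/s, and z^n \<le> n! e^z is a single term of the exponential series. The form K^2 + y^2
  anticipates the rescaling of 1 + r^2 by \<alpha>^2.\<close>

lemma powr_mult_exp_bounded:
  fixes s \<tau> m K :: real
  assumes "s > 0" "\<tau> > 0" "m > 0" "K \<ge> 1"
  shows "\<exists>B\<ge>0. \<forall>y\<ge>0. (K\<^sup>2 + y\<^sup>2) powr (m / 2) * exp (- \<tau> * y powr s) \<le> B"
proof -
  define n where "n = nat \<lceil>m / s\<rceil>"
  have "m / s \<le> real n" unfolding n_def by linarith
  hence n: "m \<le> s * real n" using assms by (simp add: field_simps)
  define c where "c = (K\<^sup>2 + 1) powr (m / 2)"
  define B where "B = c * (1 + fact n / \<tau> ^ n)"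
  have c: "c \<ge> 0" by (simp add: c_def)
  have B: "c \<le> B" "c * (fact n / \<tau> ^ n) \<le> B"
    using c assms by (auto simp: B_def algebra_simps)
  have "(K\<^sup>2 + y\<^sup>2) powr (m / 2) * exp (- \<tau> * y powr s) \<le> B" if "y \<ge> 0" for y
  proof (cases "y \<le> 1")
    case True
    have "(K\<^sup>2 + y\<^sup>2) powr (m / 2) * exp (- \<tau> * y powr s) \<le> c * 1"
      unfolding c_def using that True assms
      by (intro mult_mono powr_mono2) (auto simp: power_le_one)
    thus ?thesis using B by simp
  next
    case False
    define z where "z = \<tau> * y powr s"
    have zz: "- \<tau> * y powr s = - z" by (simp add: z_def)
    have z: "z > 0" using False assms by (simp add: z_def)
    have "(K\<^sup>2 + y\<^sup>2) \<le> (K\<^sup>2 + 1) * y\<^sup>2"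
      using False assms mult_left_mono[of 1 "y\<^sup>2" "K\<^sup>2"] by (simp add: algebra_simps)
    hence "(K\<^sup>2 + y\<^sup>2) powr (m / 2) \<le> ((K\<^sup>2 + 1) * y\<^sup>2) powr (m / 2)"
      using assms by (intro powr_mono2) auto
    also have "\<dots> = c * (y\<^sup>2) powr (m / 2)" unfolding c_def by (rule powr_mult)
    also have "(y\<^sup>2) powr (m / 2) = y powr m"
      using False by (simp add: power2_powr_half)
    also have "c * y powr m \<le> c * y powr (s * real n)"
      using False n c by (intro mult_left_mono powr_mono) auto
    also have "y powr (s * real n) = (z / \<tau>) ^ n"
      unfolding z_def using False assms by (simp add: powr_powr[symmetric] powr_realpow)
    finally have "(K\<^sup>2 + y\<^sup>2) powr (m / 2) * exp (- \<tau> * y powr s) \<le> c * (z / \<tau>) ^ n * exp (- z)"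
      unfolding zz by (rule mult_right_mono) simp
    also have "\<dots> = c / \<tau> ^ n * (z ^ n * exp (- z))" by (simp add: power_divide)
    also have "\<dots> \<le> c / \<tau> ^ n * fact n"
    proof (intro mult_left_mono)
      have "(\<Sum>k\<in>{n}. z ^ k /\<^sub>R fact k) \<le> exp z"
        unfolding exp_def using z
        by (intro sum_le_suminf summable_exp_generic) auto
      hence "z ^ n \<le> fact n * exp z" by (simp add: field_simps)
      thus "z ^ n * exp (- z) \<le> fact n" by (simp add: exp_minus field_simps)
    qed (use c assms in auto)
    also have "\<dots> \<le> B" using B by simp
    finally show ?thesis .
  qed
  moreover have "B \<ge> 0" using B c by linarith
  ultimately show ?thesis by blast
qed

text \<open>Multiplied by \<alpha>^2, the weight 1 + r^2 becomes at most K^2 + (\<alpha> r)^2, a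
  function of the filter's own variable. As K \<ge> 1, the exponent may then be raised from (l+2)/2
  to (p+2)/2, so one B serves every l.\<close>

lemma amplification_estimate:
  fixes l p s \<tau> \<alpha> r K B :: real
  assumes "0 \<le> l" "l \<le> p" "0 < \<alpha>" "\<alpha> \<le> K" "1 \<le> K" "r \<ge> 0"
    and B: "\<And>y. y \<ge> 0 \<Longrightarrow> (K\<^sup>2 + y\<^sup>2) powr ((p + 2) / 2) * exp (- \<tau> * y powr s) \<le> B"
  shows "(1 + r\<^sup>2) powr ((l + 2) / 2) * exp (- \<tau> * (\<alpha> * r) powr s) \<le> B * \<alpha> powr - (l + 2)"
proof -
  define w where "w = (l + 2) / 2"
  have w: "0 \<le> w" "w \<le> (p + 2) / 2" using assms by (auto simp: w_def)
  have "\<alpha>\<^sup>2 \<le> K\<^sup>2" using assms by (intro power_mono) auto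
  hence "\<alpha>\<^sup>2 * (1 + r\<^sup>2) \<le> K\<^sup>2 + (\<alpha> * r)\<^sup>2" by (simp add: algebra_simps power_mult_distrib)
  hence "(\<alpha>\<^sup>2 * (1 + r\<^sup>2)) powr w \<le> (K\<^sup>2 + (\<alpha> * r)\<^sup>2) powr w"
    using w by (intro powr_mono2) auto
  also have "\<dots> \<le> (K\<^sup>2 + (\<alpha> * r)\<^sup>2) powr ((p + 2) / 2)"
  proof (intro powr_mono w)
    have "1 \<le> K\<^sup>2" using assms by (simp add: one_le_power)
    thus "1 \<le> K\<^sup>2 + (\<alpha> * r)\<^sup>2" by (simp add: add_increasing2)
  qed
  finally have "(\<alpha>\<^sup>2 * (1 + r\<^sup>2)) powr w * exp (- \<tau> * (\<alpha> * r) powr s) \<le>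
    (K\<^sup>2 + (\<alpha> * r)\<^sup>2) powr ((p + 2) / 2) * exp (- \<tau> * (\<alpha> * r) powr s)"
    by (intro mult_right_mono) auto
  also have "\<dots> \<le> B" using assms by (intro B) auto
  also have "(\<alpha>\<^sup>2 * (1 + r\<^sup>2)) powr w = (\<alpha>\<^sup>2) powr w * (1 + r\<^sup>2) powr w"
    by (rule powr_mult)
  also have "(\<alpha>\<^sup>2) powr w = \<alpha> powr (l + 2)"
    using assms unfolding w_def by (intro power2_powr_half)
  finally show ?thesis using assms unfolding w_def[symmetric]
    by (simp only: powr_minus) (simp add: field_simps)
qed

text \<open>At one frequency, U is the transform of the initial value, m the Mittag-Leffler factor
  and G the noisy data, so U m - G is the data error. The weight is distributed so that U appears
  with its H^p weight and the data error with none, matching the two available norm bounds.\<close>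

lemma regularization_error_pointwise:
  fixes l p s \<tau> \<alpha> r h \<psi> m D K B A :: real and U G W :: complex
  assumes l: "0 \<le> l" "l \<le> p" "p - l \<le> s" and \<tau>: "\<tau> > 0"
    and \<alpha>: "0 < \<alpha>" "\<alpha> \<le> K" and K: "1 \<le> K" and r: "r \<ge> 0"
    and h: "0 \<le> h" "h \<le> 1 / 2" "h \<le> \<alpha> powr (p + 2)"
    and D: "0 < D" "1 / (D * (1 + r\<^sup>2)) \<le> m" and m: "m > 0"
    and \<psi>: "\<psi> > 0" "\<bar>(\<psi> - m) / m\<bar> \<le> h"
    and B: "\<And>y. y \<ge> 0 \<Longrightarrow> (K\<^sup>2 + y\<^sup>2) powr ((p + 2) / 2) * exp (- \<tau> * y powr s) \<le> B"
    and A: "A = max 1 \<tau> + 2 * K powr (p + 2)"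
    and W: "W = U - of_real (exp (- \<tau> * (\<alpha> * r) powr s)) * (G / of_real \<psi>)"
  shows "(1 + r\<^sup>2) powr (l / 2) * norm W \<le>
    A * \<alpha> powr (p - l) * ((1 + r\<^sup>2) powr (p / 2) * norm U) +
    2 * D * B * \<alpha> powr - (l + 2) * norm (U * of_real m - G)"
proof -
  define X where "X = exp (- \<tau> * (\<alpha> * r) powr s)"
  define d where "d = U * of_real m - G"
  define \<rho> where "\<rho> = (1 + r\<^sup>2)"
  have \<rho>: "\<rho> \<ge> 1" by (simp add: \<rho>_def)
  have X: "0 < X" "X \<le> 1" using \<tau> by (auto simp: X_def)
  have \<psi>m: "\<bar>\<psi> - m\<bar> \<le> h * m" using \<psi>(2) m by (simp add: abs_divide pos_divide_le_eq)
  \<comment> \<open>With h \<le> 1/2, \<psi> is at least m/2; errors relative to m become errors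
    relative to \<psi> at the cost of a factor 2.\<close>
  have "h * m \<le> 1 / 2 * m" using h m by (intro mult_right_mono) auto
  hence \<psi>2: "m / 2 \<le> \<psi>" using \<psi>m by linarith
  have inv: "1 / \<psi> \<le> 2 * D * \<rho>"
  proof -
    have "1 / \<psi> \<le> 2 / m" using \<psi>2 m \<psi>(1) by (simp add: field_simps)
    also have "2 / m \<le> 2 * D * \<rho>"
    proof -
      have "D * \<rho> > 0" using D \<rho> by simp
      hence "1 \<le> m * (D * \<rho>)" using D(2) unfolding \<rho>_def[symmetric] by (simp only: pos_divide_le_eq)
      thus ?thesis using m by (simp add: pos_divide_le_eq mult_ac)
    qed
    finally show ?thesis .
  qed
  have rel: "\<bar>\<psi> - m\<bar> / \<psi> \<le> 2 * h"
  proof -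
    have "\<bar>\<psi> - m\<bar> \<le> 2 * h * \<psi>"
      using \<psi>m mult_left_mono[OF \<psi>2 h(1)] by simp
    thus ?thesis using \<psi>(1) by (simp add: pos_divide_le_eq)
  qed
  \<comment> \<open>X U and X U m / \<psi> are inserted between U and X G / \<psi>.\<close>
  have "W = of_real (1 - X) * U + of_real X * (U * of_real ((\<psi> - m) / \<psi>)) + of_real (X * (1 / \<psi>)) * d"
    using \<psi>(1) unfolding W X_def[symmetric] d_def by (simp add: field_simps)
  hence "norm W \<le> norm (of_real (1 - X) * U) + norm (of_real X * (U * of_real ((\<psi> - m) / \<psi>))) + norm (of_real (X * (1 / \<psi>)) * d)"
    using norm_triangle_ineq order_trans add_right_mono by (metis (no_types, lifting))
  also have "\<dots> = (1 - X) * norm U + X * (norm U * (\<bar>\<psi> - m\<bar> / \<psi>)) + X * (1 / \<psi>) * norm d"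
    using X \<psi>(1) by (simp add: norm_mult norm_divide del: of_real_diff of_real_mult of_real_divide)
  also have "\<dots> \<le> (1 - X) * norm U + 1 * (norm U * (2 * h)) + X * (2 * D * \<rho>) * norm d"
    using X rel inv \<psi>(1) h by (intro add_mono mult_mono mult_left_mono mult_right_mono) auto
  finally have "\<rho> powr (l / 2) * norm W \<le> \<rho> powr (l / 2) * ((1 - X) * norm U + 1 * (norm U * (2 * h)) + X * (2 * D * \<rho>) * norm d)"
    by (rule mult_left_mono) simp
  also have "\<dots> = (\<rho> powr (l / 2) * (1 - X)) * norm U + \<rho> powr (l / 2) * (2 * h) * norm U +
      2 * D * ((\<rho> powr (l / 2) * \<rho>) * X) * norm d"
    by (simp add: algebra_simps)
  also have "\<dots> \<le> (max 1 \<tau> * \<alpha> powr (p - l) * \<rho> powr (p / 2)) * norm U +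
      (2 * K powr (p + 2) * \<alpha> powr (p - l) * \<rho> powr (p / 2)) * norm U +
      2 * D * (B * \<alpha> powr - (l + 2)) * norm d"
  proof (intro add_mono mult_right_mono mult_left_mono)
    show "\<rho> powr (l / 2) * (1 - X) \<le> max 1 \<tau> * \<alpha> powr (p - l) * \<rho> powr (p / 2)"
      unfolding \<rho>_def X_def by (rule smoothing_estimate[OF l \<tau> \<alpha>(1) r])
    \<comment> \<open>Of the power \<alpha>^(p+2) that bounds h, only \<alpha>^(p-l) is wanted; the
      rest is bounded by K^(p+2), uniformly in l.\<close>
    have "\<alpha> powr (p + 2) = \<alpha> powr (p - l) * \<alpha> powr (l + 2)" unfolding powr_add[symmetric] by simp
    also have "\<dots> \<le> \<alpha> powr (p - l) * K powr (l + 2)"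
      using \<alpha> l by (intro mult_left_mono powr_mono2) auto
    also have "\<dots> \<le> \<alpha> powr (p - l) * K powr (p + 2)"
      using K l by (intro mult_left_mono powr_mono) auto
    finally have hK: "h \<le> \<alpha> powr (p - l) * K powr (p + 2)" using h by linarith
    have "\<rho> powr (l / 2) * (2 * h) \<le> \<rho> powr (p / 2) * (2 * (\<alpha> powr (p - l) * K powr (p + 2)))"
      using \<rho> l hK h by (intro mult_mono powr_mono) auto
    thus "\<rho> powr (l / 2) * (2 * h) \<le> 2 * K powr (p + 2) * \<alpha> powr (p - l) * \<rho> powr (p / 2)"
      by (simp add: mult_ac)
    have "\<rho> powr (l / 2) * \<rho> = \<rho> powr ((l + 2) / 2)"
      using \<rho> by (simp add: add_divide_distrib powr_add)
    thus "\<rho> powr (l / 2) * \<rho> * X \<le> B * \<alpha> powr - (l + 2)"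
      unfolding \<rho>_def X_def using amplification_estimate[OF l(1,2) \<alpha> K r B] by simp
  qed (use D in auto)
  also have "\<dots> = A * \<alpha> powr (p - l) * (\<rho> powr (p / 2) * norm U) + 2 * D * B * \<alpha> powr - (l + 2) * norm d"
    unfolding A by (simp add: algebra_simps)
  finally show ?thesis unfolding \<rho>_def d_def .
qed

text \<open>C is fixed before E, \<delta>, h and l and depends on \<gamma>, T, \<tau>, s, p, the
  dimension and the bound M on \<delta>/E. Such a bound reflects a real limit: frequencies below
  1/\<alpha> pass the filter with a factor at least e^(-\<tau>), so data noise there can leave an
  error of order \<delta>, whereas for h = 0 the claimed rate is \<delta>
  (E/\<delta>)^((l+2)/(p+2)), of smaller order as \<delta>/E grows. Membership in
  \<open>sobolev_space l\<close> is asserted because the norm is meaningful only there.\<close>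

theorem theorem3:
  fixes \<gamma> T \<tau> s p M :: real
  assumes "0 < \<gamma>" "\<gamma> < 1" and "T > 0" and "\<tau> > 0" and "s > 0" and "p > 0"
  shows "\<exists>C::real.
    \<forall>(E::real) (\<delta>::real) (h::real)
      (u :: real \<Rightarrow> 'a::euclidean_space \<Rightarrow> complex) (g :: 'a \<Rightarrow> complex) (g\<delta> :: 'a \<Rightarrow> complex)
      (\<psi> :: real \<Rightarrow> real \<Rightarrow> real) (v :: 'a \<Rightarrow> complex).
      E > 0 \<longrightarrow> \<delta> > 0 \<longrightarrow> \<delta> \<le> M * E \<longrightarrow> 0 \<le> h \<longrightarrow> h \<le> 1 / 2 \<longrightarrow>
      is_final_value_solution \<gamma> T g u \<longrightarrow>
      u 0 \<in> sobolev_space p \<longrightarrow> sobolev_norm p (u 0) \<le> E \<longrightarrow>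
      g\<delta> \<in> L2_space \<longrightarrow> L2_norm (\<lambda>x. g x - g\<delta> x) \<le> \<delta> \<longrightarrow>
      approximates_mittag_leffler TYPE('a) \<gamma> T h \<psi> \<longrightarrow>
      is_regularized_initial_value \<tau> s T \<psi> ((h + \<delta> / E) powr (1 / (p + 2))) g\<delta> v \<longrightarrow>
      (\<forall>l\<in>{0..p}. p - l \<le> s \<longrightarrow>
         (\<lambda>x. u 0 x - v x) \<in> sobolev_space l \<and>
         sobolev_norm l (\<lambda>x. u 0 x - v x)
           \<le> C * E powr ((2 + l) / (p + 2)) * (\<delta> + h * E) powr ((p - l) / (p + 2)))"
proof -
  \<comment> \<open>An upper bound for \<alpha>, since h + \<delta>/E \<le> 1 + |M|.\<close>
  define K where "K = (1 + \<bar>M\<bar>) powr (1 / (p + 2))"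
  have K: "K \<ge> 1" unfolding K_def using assms by (intro ge_one_powr_ge_zero) auto
  obtain B where B: "B \<ge> 0" "\<And>y. y \<ge> 0 \<Longrightarrow> (K\<^sup>2 + y\<^sup>2) powr ((p + 2) / 2) * exp (- \<tau> * y powr s) \<le> B"
    using powr_mult_exp_bounded[OF \<open>s > 0\<close> \<open>\<tau> > 0\<close> _ K, of "p + 2"] \<open>p > 0\<close> by auto
  have Gam: "Gamma (1 - \<gamma>) > 0" using assms by (intro Gamma_real_pos) auto
  \<comment> \<open>From 1 + a r^2 \<le> (1 + a) (1 + r^2) with a = Gamma(1 - \<gamma>)
    T^\<gamma>.\<close>
  define D where "D = 1 + Gamma (1 - \<gamma>) * T powr \<gamma>"
  have D: "D \<ge> 1" using Gam unfolding D_def by (simp del: Gamma_real_pos)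
  define A where "A = max 1 \<tau> + 2 * K powr (p + 2)"
  have A: "A \<ge> 0" unfolding A_def by (intro add_nonneg_nonneg) auto
  \<comment> \<open>The outer sqrt 2 comes from passing to norms, the inner one from the L2 bound
    for the transform of the data error.\<close>
  define C where "C = sqrt 2 * (A + 2 * D * B * sqrt 2)"
  have ml: "1 / (D * (1 + r\<^sup>2)) \<le> mittag_leffler \<gamma> (- r\<^sup>2 * T powr \<gamma>)"
    "0 < mittag_leffler \<gamma> (- r\<^sup>2 * T powr \<gamma>)" for r :: real
  proof -
    have x: "r\<^sup>2 * T powr \<gamma> \<ge> 0" by simp
    have lb: "1 / (1 + Gamma (1 - \<gamma>) * (r\<^sup>2 * T powr \<gamma>)) \<le> mittag_leffler \<gamma> (- r\<^sup>2 * T powr \<gamma>)"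
      using mittag_leffler_lower_bound[OF assms(1,2) x] by simp
    have n: "Gamma (1 - \<gamma>) * T powr \<gamma> \<ge> 0" "Gamma (1 - \<gamma>) * (r\<^sup>2 * T powr \<gamma>) \<ge> 0"
      using Gam by (auto intro!: mult_nonneg_nonneg simp del: Gamma_real_pos)
    have "1 + Gamma (1 - \<gamma>) * (r\<^sup>2 * T powr \<gamma>) \<le> D * (1 + r\<^sup>2)"
      unfolding D_def using n(1) by (simp add: algebra_simps)
    hence "1 / (D * (1 + r\<^sup>2)) \<le> 1 / (1 + Gamma (1 - \<gamma>) * (r\<^sup>2 * T powr \<gamma>))"
      using n(2) D by (intro divide_left_mono mult_pos_pos) (auto intro: add_pos_nonneg less_le_trans)
    with lb show "1 / (D * (1 + r\<^sup>2)) \<le> mittag_leffler \<gamma> (- r\<^sup>2 * T powr \<gamma>)" by linarith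
    moreover have "1 / (D * (1 + r\<^sup>2)) > 0" using D by (auto intro!: divide_pos_pos mult_pos_pos add_pos_nonneg)
    ultimately show "0 < mittag_leffler \<gamma> (- r\<^sup>2 * T powr \<gamma>)" by linarith
  qed
  show ?thesis
  proof (intro exI[of _ C] allI impI ballI)
    fix E \<delta> h :: real and u :: "real \<Rightarrow> 'a \<Rightarrow> complex" and g g\<delta> v :: "'a \<Rightarrow> complex"
      and \<psi> :: "real \<Rightarrow> real \<Rightarrow> real" and l :: real
    assume E: "E > 0" and \<delta>: "\<delta> > 0" "\<delta> \<le> M * E" and h: "0 \<le> h" "h \<le> 1 / 2"
      and sol: "is_final_value_solution \<gamma> T g u"
      and u0: "u 0 \<in> sobolev_space p" "sobolev_norm p (u 0) \<le> E"
      and g\<delta>: "g\<delta> \<in> L2_space" "L2_norm (\<lambda>x. g x - g\<delta> x) \<le> \<delta>"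
      and app: "approximates_mittag_leffler TYPE('a) \<gamma> T h \<psi>"
      and reg: "is_regularized_initial_value \<tau> s T \<psi> ((h + \<delta> / E) powr (1 / (p + 2))) g\<delta> v"
      and l: "l \<in> {0..p}" "p - l \<le> s"
    define \<alpha> where "\<alpha> = (h + \<delta> / E) powr (1 / (p + 2))"
    define q where "q = h + \<delta> / E"
    have q: "q > 0" using h \<delta> E by (simp add: q_def add_nonneg_pos)
    have "\<delta> / E \<le> M" using \<delta> E by (simp add: pos_divide_le_eq)
    hence "q \<le> 1 + \<bar>M\<bar>" using h unfolding q_def by linarith
    hence \<alpha>K: "\<alpha> \<le> K" unfolding \<alpha>_def K_def q_def[symmetric] using q assms by (intro powr_mono2) auto
    have \<alpha>: "\<alpha> > 0" using q unfolding \<alpha>_def q_def[symmetric] by simp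
    have \<alpha>p: "\<alpha> powr (p + 2) = q"
      using q \<open>p > 0\<close> unfolding \<alpha>_def q_def[symmetric] by (simp add: powr_powr)
    have h\<alpha>: "h \<le> \<alpha> powr (p + 2)" unfolding \<alpha>p q_def using \<delta> E by simp
    have \<delta>q: "\<delta> \<le> E * q" unfolding q_def using h E by (simp add: distrib_left)
    have u_L2: "u 0 \<in> L2_space" "u T \<in> L2_space"
      using sol \<open>T > 0\<close> by (auto simp: is_final_value_solution_def is_solution_def)
    have g_L2: "g \<in> L2_space" using sol by (simp add: is_final_value_solution_def)
    have v_L2: "v \<in> L2_space" using reg by (simp add: is_regularized_initial_value_def)
    have ae1: "AE \<xi> in lborel. fourier (\<lambda>x. u 0 x - v x) \<xi> = fourier (u 0) \<xi> - fourier v \<xi>"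
      by (rule fourier_diff_AE[OF u_L2(1) v_L2])
    have ae2: "AE \<xi> in lborel. fourier (u T) \<xi> = fourier g \<xi>"
      using sol by (intro fourier_cong_AE u_L2 g_L2) (simp add: is_final_value_solution_def)
    have ae3: "AE \<xi> in lborel. fourier (u T) \<xi> =
       fourier (u 0) \<xi> * of_real (mittag_leffler \<gamma> (- (norm \<xi>)\<^sup>2 * T powr \<gamma>))"
      using sol \<open>T > 0\<close> by (auto simp: is_final_value_solution_def is_solution_def)
    have ae4: "AE \<xi> in lborel. fourier v \<xi> =
       of_real (exp (- \<tau> * (\<alpha> * norm \<xi>) powr s)) * (fourier g\<delta> \<xi> / of_real (\<psi> (norm \<xi>) T))"
      using reg unfolding is_regularized_initial_value_def \<alpha>_def by blast
    have \<psi>_pos: "\<psi> r T > 0" if "r \<ge> 0" for r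
      using app that \<open>T > 0\<close> by (auto simp: approximates_mittag_leffler_def)
    have \<psi>_app: "\<bar>(\<psi> (norm \<xi>) T - mittag_leffler \<gamma> (- (norm \<xi>)\<^sup>2 * T powr \<gamma>)) /
        mittag_leffler \<gamma> (- (norm \<xi>)\<^sup>2 * T powr \<gamma>)\<bar> \<le> h" for \<xi> :: 'a
    proof -
      have "sup_norm (\<lambda>\<xi>::'a. (\<psi> (norm \<xi>) T - mittag_leffler \<gamma> (- (norm \<xi>)\<^sup>2 * T powr \<gamma>)) /
        mittag_leffler \<gamma> (- (norm \<xi>)\<^sup>2 * T powr \<gamma>)) \<le> ereal h"
        using app \<open>T > 0\<close> by (simp add: approximates_mittag_leffler_def)
      thus ?thesis unfolding sup_norm_def SUP_le_iff by (metis UNIV_I ereal_less_eq(3))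
    qed
    let ?d = "\<lambda>\<xi>. fourier g \<xi> - fourier g\<delta> \<xi>"
    have bound: "AE \<xi> in lborel. norm (sobolev_weighted l (\<lambda>x. u 0 x - v x) \<xi>) \<le>
       A * \<alpha> powr (p - l) * norm (sobolev_weighted p (u 0) \<xi>) +
       2 * D * B * \<alpha> powr - (l + 2) * norm (?d \<xi>)"
      using ae1 ae2 ae3 ae4
    proof eventually_elim
      case (elim \<xi>)
      let ?m = "mittag_leffler \<gamma> (- (norm \<xi>)\<^sup>2 * T powr \<gamma>)"
      have "(1 + (norm \<xi>)\<^sup>2) powr (l / 2) * norm (fourier (\<lambda>x. u 0 x - v x) \<xi>) \<le>
        A * \<alpha> powr (p - l) * ((1 + (norm \<xi>)\<^sup>2) powr (p / 2) * norm (fourier (u 0) \<xi>)) +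
        2 * D * B * \<alpha> powr - (l + 2) * norm (fourier (u 0) \<xi> * of_real ?m - fourier g\<delta> \<xi>)"
        by (rule regularization_error_pointwise[where h = h and K = K and \<tau> = \<tau> and s = s and \<psi> = "\<psi> (norm \<xi>) T"])
          (use l \<open>\<tau> > 0\<close> \<alpha> \<alpha>K K h h\<alpha> D ml[of "norm \<xi>"] \<psi>_pos[of "norm \<xi>"] \<psi>_app[of \<xi>] B A_def elim in auto)
      thus ?case using elim unfolding sobolev_weighted_def by (simp add: norm_mult)
    qed
    have w_L2: "sobolev_weighted p (u 0) \<in> L2_space" using u0 by (simp add: sobolev_space_def)
    have d_L2: "?d \<in> L2_space" by (intro L2_space_diff fourier_L2_space g_L2 g\<delta>)
    have uv: "(\<lambda>x. u 0 x - v x) \<in> L2_space" by (rule L2_space_diff[OF u_L2(1) v_L2])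
    have [measurable]: "fourier (\<lambda>x. u 0 x - v x) \<in> borel_measurable borel"
      using fourier_L2_space[OF uv] by (simp add: L2_space_iff)
    have meas: "sobolev_weighted l (\<lambda>x. u 0 x - v x) \<in> borel_measurable borel"
      unfolding sobolev_weighted_def[abs_def] by measurable
    have nn: "A * \<alpha> powr (p - l) \<ge> 0" "2 * D * B * \<alpha> powr - (l + 2) \<ge> 0"
      using A D B(1) by auto
    note * = L2_norm_le_of_AE_bound[OF meas w_L2 d_L2 nn bound]
    have "sobolev_norm l (\<lambda>x. u 0 x - v x) \<le>
      sqrt 2 * (A * \<alpha> powr (p - l) * L2_norm (sobolev_weighted p (u 0)) +
        2 * D * B * \<alpha> powr - (l + 2) * L2_norm ?d)"
      unfolding sobolev_norm_def by (rule *(2))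
    also have "\<dots> \<le> sqrt 2 * (A * \<alpha> powr (p - l) * E + 2 * D * B * \<alpha> powr - (l + 2) * (sqrt 2 * (E * q)))"
    proof (intro mult_left_mono add_mono)
      show "L2_norm (sobolev_weighted p (u 0)) \<le> E" using u0 by (simp add: sobolev_norm_def)
      have "L2_norm ?d \<le> sqrt 2 * L2_norm (\<lambda>x. g x - g\<delta> x)" by (rule L2_norm_fourier_diff[OF g_L2 g\<delta>(1)])
      also have "\<dots> \<le> sqrt 2 * (E * q)" using g\<delta>(2) \<delta>q by (intro mult_left_mono) auto
      finally show "L2_norm ?d \<le> sqrt 2 * (E * q)" .
    qed (use nn in auto)
    also have "\<dots> = sqrt 2 * (A * (E * \<alpha> powr (p - l)) + 2 * D * B * sqrt 2 * (E * (\<alpha> powr - (l + 2) * q)))"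
      by (simp add: mult_ac)
    \<comment> \<open>The balance: q = \<alpha>^(p+2) gives the amplified data error the same order
      as the smoothing error.\<close>
    also have "\<alpha> powr - (l + 2) * q = \<alpha> powr (p - l)"
      unfolding \<alpha>p[symmetric] powr_add[symmetric] by simp
    also have "sqrt 2 * (A * (E * \<alpha> powr (p - l)) + 2 * D * B * sqrt 2 * (E * \<alpha> powr (p - l))) = C * (E * \<alpha> powr (p - l))"
      unfolding C_def by (simp add: algebra_simps)
    \<comment> \<open>Since q = (\<delta> + h E)/E, the surviving power of E is 1 - (p-l)/(p+2) =
      (2+l)/(p+2).\<close>
    also have "E * \<alpha> powr (p - l) = E powr ((2 + l) / (p + 2)) * (\<delta> + h * E) powr ((p - l) / (p + 2))"
    proof -
      have "\<alpha> powr (p - l) = q powr ((p - l) / (p + 2))"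
        unfolding \<alpha>_def q_def[symmetric] by (simp add: powr_powr)
      also have "q = (\<delta> + h * E) / E" unfolding q_def using E by (simp add: field_simps)
      also have "((\<delta> + h * E) / E) powr ((p - l) / (p + 2)) =
         (\<delta> + h * E) powr ((p - l) / (p + 2)) / E powr ((p - l) / (p + 2))"
        by (rule powr_divide)
      finally have "E * \<alpha> powr (p - l) = (E powr 1 / E powr ((p - l) / (p + 2))) * (\<delta> + h * E) powr ((p - l) / (p + 2))"
        using E by simp
      also have "E powr 1 / E powr ((p - l) / (p + 2)) = E powr (1 - (p - l) / (p + 2))"
        by (rule powr_diff[symmetric])
      also have "1 - (p - l) / (p + 2) = (2 + l) / (p + 2)"
        using \<open>p > 0\<close> by (simp add: field_simps)
      finally show ?thesis .
    qed
    finally have "sobolev_norm l (\<lambda>x. u 0 x - v x) \<le> C * E powr ((2 + l) / (p + 2)) * (\<delta> + h * E) powr ((p - l) / (p + 2))"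
      by (simp only: mult.assoc)
    moreover have "(\<lambda>x. u 0 x - v x) \<in> sobolev_space l"
      using uv *(1) by (simp add: sobolev_space_def)
    ultimately show "(\<lambda>x. u 0 x - v x) \<in> sobolev_space l \<and>
         sobolev_norm l (\<lambda>x. u 0 x - v x)
           \<le> C * E powr ((2 + l) / (p + 2)) * (\<delta> + h * E) powr ((p - l) / (p + 2))" by blast
  qed
qed

end
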